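(* Let $n\ge 1$, let $\mathbf{f}:\mathbb{R}^n\to\mathbb{R}^n$ have polynomial entries and let $\Phi:\mathbb{R}^n\to\mathbb{R}$ be a polynomial. Assume that for every $\mathbf{a}_0\in\mathbb{R}^n$ the solution $\mathbf{a}(t;\mathbf{a}_0)$ of $\frac{d\mathbf{a}}{dt}=\mathbf{f}(\mathbf{a})$, $\mathbf{a}(0)=\mathbf{a}_0$, exists for all times $t\ge 0$. Let $g_1,\dots,g_m$ be $n$-variate real polynomials of degree at most $s$ such that the semialgebraic set $\Omega=\{\mathbf{a}\in\mathbb{R}^n : g_1(\mathbf{a})\ge 0,\dots,g_m(\mathbf{a})\ge 0\}$ is compact, and assume that every solution eventually remains in $\Omega$, i.e. for every $\mathbf{a}_0\in\mathbb{R}^n$ there is $t_0\ge 0$ with $\mathbf{a}(t;\mathbf{a}_0)\in\Omega$ for all $t\ge t_0$. With $\overline{\Phi}^*$, $\Pi_{n,d}$ and $\Lambda_d$ as defined in the context, suppose that there exists $L\in\mathbb{R}$ such that the polynomial $L-\|\mathbf{a}\|^2$ belongs to $\Lambda_d$ for some integer $d$. Then $$\overline{\Phi}^* = \lim_{d\to+\infty}\ \inf_{V\in\Pi_{n,d},\ \lambda\in\mathbb{R}}\left\{\lambda \ :\ \lambda-\Phi-\mathbf{f}\cdot\nabla V\in\Lambda_d\right\}.$$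
   Context: Infinite-time averages: for $\mathbf{a}_0\in\mathbb{R}^n$, $\overline{\Phi}(\mathbf{a}_0):=\limsup_{T\to\infty}\frac1T\int_0^T\Phi[\mathbf{a}(t;\mathbf{a}_0)]\,dt$, and $\overline{\Phi}^*:=\max_{\mathbf{a}_0\in\Omega}\overline{\Phi}(\mathbf{a}_0)$ (this maximum is known to be attained under the stated assumptions). Notation: $\Pi_{n,d}$ is the set of $n$-variate real polynomials of degree at most $d$. $\Sigma_{n,q}$ is the set of $n$-variate polynomials of degree at most $q$ that are sums of squares of real polynomials. $\|\cdot\|$ is the Euclidean norm. $\deg(\mathbf{f})$ is the maximum degree of the entries of $\mathbf{f}$, and $$r(d):=\max\{\deg(\Phi),\ \deg(\mathbf{f})+d-1\}.$$ For each integer $d$ such that $r(d)\ge s$, $$\Lambda_d:=\left\{\sigma_0+\sum_{i=1}^m\sigma_i g_i \ :\ \sigma_0\in\Sigma_{n,r(d)},\ \sigma_1,\dots,\sigma_m\in\Sigma_{n,r(d)-s}\right\}.$$ The infimum over an empty set is $+\infty$; the limit is over integers $d$ with $r(d)\ge s$. *)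

theory Defs
  imports "HOL-Analysis.Analysis" "HOL-Library.Poly_Mapping"
begin

text \<open>
  A real polynomial in the variables indexed by \<open>'n\<close> maps each exponent vector
  to its coefficient; the ring operations are those of \<open>Poly_Mapping\<close>.
\<close>
type_synonym 'n rpoly = "('n \<Rightarrow>\<^sub>0 nat) \<Rightarrow>\<^sub>0 real"

definition pconst :: "real \<Rightarrow> 'n::finite rpoly" where
  "pconst c = Poly_Mapping.single 0 c"

definition pvar :: "'n::finite \<Rightarrow> 'n rpoly" where
  "pvar i = Poly_Mapping.single (Poly_Mapping.single i 1) 1"

definition peval :: "'n::finite rpoly \<Rightarrow> real ^ 'n \<Rightarrow> real" where
  "peval p x = (\<Sum>e\<in>Poly_Mapping.keys p.
     Poly_Mapping.lookup p e * (\<Prod>i\<in>UNIV. (x $ i) ^ Poly_Mapping.lookup e i))"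

text \<open>The zero polynomial gets total degree 0.\<close>
definition pdeg :: "'n::finite rpoly \<Rightarrow> nat" where
  "pdeg p = Max (insert 0
     ((\<lambda>e. \<Sum>i\<in>UNIV. Poly_Mapping.lookup e i) ` Poly_Mapping.keys p))"

text \<open>
  Subtraction of exponents is truncated, but a monomial not containing variable \<open>i\<close>
  contributes the coefficient 0.
\<close>
definition pdiff :: "'n::finite \<Rightarrow> 'n rpoly \<Rightarrow> 'n rpoly" where
  "pdiff i p = (\<Sum>e\<in>Poly_Mapping.keys p.
     Poly_Mapping.single (e - Poly_Mapping.single i 1)
       (Poly_Mapping.lookup p e * real (Poly_Mapping.lookup e i)))"

definition norm_sq_poly :: "'n::finite rpoly" where
  "norm_sq_poly = (\<Sum>i\<in>UNIV. pvar i ^ 2)"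

text \<open>A polynomial vector field is the family of its entries.\<close>
definition field_eval :: "('n::finite \<Rightarrow> 'n rpoly) \<Rightarrow> real ^ 'n \<Rightarrow> real ^ 'n" where
  "field_eval f x = (\<chi> i. peval (f i) x)"

definition field_deg :: "('n::finite \<Rightarrow> 'n rpoly) \<Rightarrow> nat" where
  "field_deg f = Max (range (\<lambda>i. pdeg (f i)))"

definition dot_grad :: "('n::finite \<Rightarrow> 'n rpoly) \<Rightarrow> 'n rpoly \<Rightarrow> 'n rpoly" where
  "dot_grad f V = (\<Sum>i\<in>UNIV. f i * pdiff i V)"

definition Pi_poly :: "int \<Rightarrow> 'n::finite rpoly set" where
  "Pi_poly d = {p. int (pdeg p) \<le> d}"

definition SOS :: "int \<Rightarrow> 'n::finite rpoly set" where
  "SOS q = {p. int (pdeg p) \<le> q \<and>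
     (\<exists>(k::nat) (h :: nat \<Rightarrow> 'n rpoly). p = (\<Sum>j<k. h j ^ 2))}"

definition rdeg :: "('n::finite \<Rightarrow> 'n rpoly) \<Rightarrow> 'n rpoly \<Rightarrow> int \<Rightarrow> int" where
  "rdeg f \<Phi> d = max (int (pdeg \<Phi>)) (int (field_deg f) + d - 1)"

text \<open>Only meaningful for \<open>d\<close> with \<open>rdeg f \<Phi> d \<ge> s\<close>.\<close>
definition Lambda ::
  "('n::finite \<Rightarrow> 'n rpoly) \<Rightarrow> 'n rpoly \<Rightarrow> nat \<Rightarrow> nat \<Rightarrow> (nat \<Rightarrow> 'n rpoly) \<Rightarrow> int \<Rightarrow> 'n rpoly set"
  where
  "Lambda f \<Phi> s m g d =
     {\<sigma> 0 + (\<Sum>i=1..m. \<sigma> i * g i) | \<sigma> :: nat \<Rightarrow> 'n rpoly.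
        \<sigma> 0 \<in> SOS (rdeg f \<Phi> d) \<and> (\<forall>i\<in>{1..m}. \<sigma> i \<in> SOS (rdeg f \<Phi> d - int s))}"

definition semialg_set :: "nat \<Rightarrow> (nat \<Rightarrow> 'n::finite rpoly) \<Rightarrow> (real ^ 'n) set" where
  "semialg_set m g = {x. \<forall>i\<in>{1..m}. peval (g i) x \<ge> 0}"

definition forward_solution ::
  "(real ^ 'n::finite \<Rightarrow> real ^ 'n) \<Rightarrow> real ^ 'n \<Rightarrow> (real \<Rightarrow> real ^ 'n) \<Rightarrow> bool" where
  "forward_solution F x0 x \<longleftrightarrow>
     x 0 = x0 \<and> (\<forall>t\<ge>0. (x has_vector_derivative F (x t)) (at t within {0..}))"

text \<open>Here \<open>a x0 t\<close> is the state at time \<open>t\<close> of the solution starting at \<open>x0\<close>.\<close>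
definition time_average ::
  "'n::finite rpoly \<Rightarrow> (real ^ 'n \<Rightarrow> real \<Rightarrow> real ^ 'n) \<Rightarrow> real ^ 'n \<Rightarrow> ereal" where
  "time_average \<Phi> a x0 =
     Limsup at_top (\<lambda>T::real. ereal (1 / T * integral {0..T} (\<lambda>t. peval \<Phi> (a x0 t))))"

text \<open>The maximum, not the supremum: no value is specified unless it is attained on \<open>\<Omega>\<close>.\<close>
definition max_time_average ::
  "'n::finite rpoly \<Rightarrow> (real ^ 'n \<Rightarrow> real \<Rightarrow> real ^ 'n) \<Rightarrow> (real ^ 'n) set \<Rightarrow> ereal" where
  "max_time_average \<Phi> a \<Omega> = (GREATEST y. y \<in> time_average \<Phi> a ` \<Omega>)"

definition sos_bound ::
  "('n::finite \<Rightarrow> 'n rpoly) \<Rightarrow> 'n rpoly \<Rightarrow> nat \<Rightarrow> nat \<Rightarrow> (nat \<Rightarrow> 'n rpoly) \<Rightarrow> int \<Rightarrow> ereal" where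
  "sos_bound f \<Phi> s m g d =
     Inf {ereal l | l V. V \<in> Pi_poly d \<and> pconst l - \<Phi> - dot_grad f V \<in> Lambda f \<Phi> s m g d}"

end

theory Submission
  imports Defs
begin

text \<open>
  One inequality is the usual one: if \<open>l - \<Phi> - f \<bullet> \<nabla>V\<close> lies in the quadratic module of \<open>g\<close>, it is
  nonnegative on \<open>\<Omega>\<close>, and integrating along a trajectory that has entered \<open>\<Omega>\<close> bounds its time average
  by \<open>l\<close> (\<open>integral_along_solution_le\<close>).

  For the other one, let \<open>p\<close> be the infimum of all \<open>l\<close> that admit such a \<open>V\<close> of any degree. It
  suffices to find one point of \<open>\<Omega>\<close> whose time average is at least \<open>p\<close>: by the first inequality this
  average is exactly \<open>p\<close>, so the maximum exists and equals \<open>p\<close>, and the bounds of bounded degree decrease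
  to \<open>p\<close> because every certificate has finite degree. The point is found as follows.

  \<^item> Time is discretised by a small step \<open>\<tau>\<close>. Let \<open>T\<close> be the time-\<open>\<tau>\<close> map and \<open>G\<close> the average of
    \<open>\<Phi>\<close> over \<open>[0,\<tau>]\<close>. Since \<open>f\<close> is polynomial, the iterated Lie derivatives of a polynomial \<open>W\<close> are
    polynomials, and on a bounded set they grow only like \<open>k!\<close> times a geometric sequence whose ratio
    does not depend on \<open>W\<close> (\<open>lie_series_term_bound\<close>). So there is one \<open>\<tau>\<close> for which all Lie series
    \<open>W \<circ> T = (\<Sum>k. \<tau>^k / k! (f \<bullet> \<nabla>)^k W)\<close> converge uniformly on \<open>\<Omega>\<close>. Truncating them shows that
    the coboundary \<open>W \<circ> T - W\<close> and the difference \<open>G - \<Phi>\<close> are uniform limits of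
    polynomials of the form \<open>f \<bullet> \<nabla>V\<close> (\<open>coboundary_approx\<close>, \<open>average_approx\<close>), and it also gives the
    continuity of \<open>T\<close> and \<open>G\<close> and the uniqueness of solutions.

  \<^item> Suppose that no orbit segment \<open>x, T x, \<dots>, T\<^sup>N\<^sup>-\<^sup>1 x\<close> inside \<open>\<Omega>\<close> has average of \<open>G\<close> at
    least \<open>l\<close>. Penalising the distance to \<open>\<Omega>\<close> and averaging gives a continuous \<open>W\<close> with
    \<open>G + W \<circ> T - W < l\<close> on \<open>\<Omega>\<close> (\<open>coboundary_certificate\<close>). Approximating \<open>W\<close> by a polynomial and using
    the previous item gives \<open>l - \<Phi> - f \<bullet> \<nabla>V > 0\<close> on \<open>\<Omega>\<close>, and Putinar's Positivstellensatz (\<open>putinar\<close>)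
    makes \<open>l\<close> admissible. Hence for \<open>l < p\<close> such segments exist for all \<open>N\<close> (\<open>infeasible_orbit\<close>).

  \<^item> A long segment with large average contains a point from which all shorter averages are large;
    by compactness some orbit stays in \<open>\<Omega>\<close> at all times \<open>k\<tau>\<close> with all averages at least \<open>p\<close>
    (\<open>optimal_orbit_exists\<close>). This replaces the usual passage through invariant measures.

  Putinar's theorem is proved by an elementary route: a penalty term makes the polynomial positive on a
  whole cube, a Bernstein expansion writes it as a nonnegative combination of products of the functions
  \<open>R \<plusminus> x\<^sub>i\<close>, and these products lie in the quadratic module of a single ball constraint, which is closed
  under multiplication.
\<close>

section \<open>Polynomials, their values and their derivatives\<close>

lemma sum_of_monomials: "(\<Sum>e\<in>Poly_Mapping.keys p. Poly_Mapping.single e (Poly_Mapping.lookup p e)) = p"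
proof (rule poly_mapping_eqI)
  fix k
  have "(\<Sum>e\<in>Poly_Mapping.keys p. Poly_Mapping.lookup (Poly_Mapping.single e (Poly_Mapping.lookup p e)) k)
      = (\<Sum>e\<in>Poly_Mapping.keys p. if e = k then Poly_Mapping.lookup p k else 0)"
    by (rule sum.cong) (auto simp: lookup_single when_def)
  then show "Poly_Mapping.lookup (\<Sum>e\<in>Poly_Mapping.keys p. Poly_Mapping.single e (Poly_Mapping.lookup p e)) k
      = Poly_Mapping.lookup p k"
    by (simp add: lookup_sum in_keys_iff)
qed

lemma peval_superset:
  assumes "finite S" "Poly_Mapping.keys p \<subseteq> S"
  shows "peval p x = (\<Sum>e\<in>S. Poly_Mapping.lookup p e * (\<Prod>i\<in>UNIV. (x $ i) ^ Poly_Mapping.lookup e i))"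
  unfolding peval_def using assms
  by (intro sum.mono_neutral_left) (auto simp: in_keys_iff)

lemma peval_add [simp]: "peval (p + q) x = peval p x + peval q x"
proof -
  let ?S = "Poly_Mapping.keys p \<union> Poly_Mapping.keys q"
  have "Poly_Mapping.keys (p + q) \<subseteq> ?S" by (rule Poly_Mapping.keys_add)
  then show ?thesis
    by (simp add: peval_superset[of ?S] lookup_add sum.distrib algebra_simps)
qed

lemma peval_zero [simp]: "peval 0 x = 0"
  by (simp add: peval_def)

lemma peval_sum [simp]: "peval (\<Sum>j\<in>S. p j) x = (\<Sum>j\<in>S. peval (p j) x)"
  by (induct S rule: infinite_finite_induct) auto

lemma peval_single:
  "peval (Poly_Mapping.single e c) x = c * (\<Prod>i\<in>UNIV. (x $ i) ^ Poly_Mapping.lookup e i)"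
  by (cases "c = 0") (auto simp: peval_def)

lemma mult_sum_of_monomials:
  fixes p q :: "'a::monoid_add \<Rightarrow>\<^sub>0 'b::semiring_0"
  shows "p * q = (\<Sum>a\<in>Poly_Mapping.keys p. \<Sum>b\<in>Poly_Mapping.keys q.
      Poly_Mapping.single (a + b) (Poly_Mapping.lookup p a * Poly_Mapping.lookup q b))"
proof -
  have "p * q = (\<Sum>a\<in>Poly_Mapping.keys p. Poly_Mapping.single a (Poly_Mapping.lookup p a))
       * (\<Sum>b\<in>Poly_Mapping.keys q. Poly_Mapping.single b (Poly_Mapping.lookup q b))"
    by (simp add: sum_of_monomials)
  then show ?thesis by (simp add: sum_product mult_single)
qed

lemma peval_mult [simp]: "peval (p * q) x = peval p x * peval q x"
proof -
  have "peval (p * q) x = (\<Sum>a\<in>Poly_Mapping.keys p. \<Sum>b\<in>Poly_Mapping.keys q.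
     peval (Poly_Mapping.single a (Poly_Mapping.lookup p a)) x * peval (Poly_Mapping.single b (Poly_Mapping.lookup q b)) x)"
    by (subst mult_sum_of_monomials) (simp add: peval_single lookup_add power_add prod.distrib algebra_simps)
  also have "\<dots> = peval (\<Sum>a\<in>Poly_Mapping.keys p. Poly_Mapping.single a (Poly_Mapping.lookup p a)) x
     * peval (\<Sum>a\<in>Poly_Mapping.keys q. Poly_Mapping.single a (Poly_Mapping.lookup q a)) x"
    by (simp add: sum_product)
  finally show ?thesis by (simp add: sum_of_monomials)
qed

lemma peval_pconst [simp]: "peval (pconst c) x = c"
  by (simp add: pconst_def peval_single)

lemma pconst_1: "pconst 1 = 1" and pconst_0 [simp]: "pconst 0 = 0"
  by (simp_all add: pconst_def)

lemma pconst_add: "pconst (a + b) = pconst a + pconst b"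
  by (simp add: pconst_def single_add)

lemma pconst_mult: "pconst (a * b) = pconst a * pconst b"
  by (simp add: pconst_def mult_single)

lemma pconst_diff: "pconst (a - b) = pconst a - pconst b"
  by (simp add: pconst_def single_diff)

lemma pconst_power: "pconst (a ^ k) = pconst a ^ k"
  by (induct k) (simp_all add: pconst_1 pconst_mult)

lemma peval_one [simp]: "peval 1 x = 1"
  by (metis pconst_1 peval_pconst)

lemma peval_power [simp]: "peval (p ^ k) x = peval p x ^ k"
  by (induct k) auto

lemma peval_uminus [simp]: "peval (- p) x = - peval p x"
  by (metis add.right_inverse peval_add peval_zero minus_unique)

lemma peval_diff [simp]: "peval (p - q) x = peval p x - peval q x"
  using peval_add[of p "- q" x] by simp

lemma peval_prod [simp]: "peval (\<Prod>j\<in>S. p j) x = (\<Prod>j\<in>S. peval (p j) x)"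
  by (induct S rule: infinite_finite_induct) auto

lemma pvar_power: "pvar i ^ k = Poly_Mapping.single (Poly_Mapping.single i k) 1"
  by (induct k) (auto simp: pvar_def mult_single simp flip: single_add)

lemma peval_pvar [simp]: "peval (pvar i) x = x $ i"
proof -
  have "(\<Prod>j\<in>UNIV. x $ j ^ Poly_Mapping.lookup (Poly_Mapping.single i 1) j)
      = (\<Prod>j\<in>UNIV. if j = i then x $ j else 1)"
    by (rule prod.cong) (auto simp: lookup_single when_def)
  then show ?thesis by (simp add: pvar_def peval_single)
qed

lemma prod_single:
  fixes e :: "'k \<Rightarrow> 'a::comm_monoid_add"
  shows "(\<Prod>i\<in>S. Poly_Mapping.single (e i) (1::'b::comm_semiring_1)) = Poly_Mapping.single (\<Sum>i\<in>S. e i) 1"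
  by (induct S rule: infinite_finite_induct) (auto simp: mult_single)

lemma monomial_eq_prod:
  fixes e :: "'n::finite \<Rightarrow>\<^sub>0 nat"
  shows "Poly_Mapping.single e c = pconst c * (\<Prod>i\<in>UNIV. pvar i ^ Poly_Mapping.lookup e i)"
proof -
  have "(\<Sum>i\<in>UNIV. Poly_Mapping.single i (Poly_Mapping.lookup e i))
     = (\<Sum>i\<in>Poly_Mapping.keys e. Poly_Mapping.single i (Poly_Mapping.lookup e i))"
    by (rule sum.mono_neutral_right) (auto simp: in_keys_iff)
  then have "(\<Sum>i\<in>UNIV. Poly_Mapping.single i (Poly_Mapping.lookup e i)) = e"
    by (simp add: sum_of_monomials)
  then show ?thesis by (simp add: pvar_power prod_single pconst_def mult_single)
qed

text \<open>
Polynomial identities with a multiplicative structure, such as membership in a span of products, are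
easier to establish by ring operations than monomial by monomial.
\<close>

lemma rpoly_induct [case_names const var add mult]:
  fixes p :: "'n::finite rpoly"
  assumes c: "\<And>c. P (pconst c)" and v: "\<And>i. P (pvar i)"
    and a: "\<And>p q. P p \<Longrightarrow> P q \<Longrightarrow> P (p + q)" and m: "\<And>p q. P p \<Longrightarrow> P q \<Longrightarrow> P (p * q)"
  shows "P p"
proof -
  have pw: "P (pvar i ^ k)" for i k
    by (induct k) (use c[of 1] v m in \<open>auto simp: pconst_1\<close>)
  have pr: "P (\<Prod>i\<in>S. pvar i ^ k i)" for S :: "'n set" and k
    by (induct S rule: infinite_finite_induct) (use c[of 1] pw m in \<open>auto simp: pconst_1\<close>)
  have "P (Poly_Mapping.single e x)" for e :: "'n \<Rightarrow>\<^sub>0 nat" and x :: real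
    by (subst monomial_eq_prod) (intro m c pr)
  then have "P (\<Sum>e\<in>S. Poly_Mapping.single e (h e))" for S :: "('n \<Rightarrow>\<^sub>0 nat) set" and h
    by (induct S rule: infinite_finite_induct) (use c[of 0] a in auto)
  from this[of "Poly_Mapping.lookup p" "Poly_Mapping.keys p"] show ?thesis by (simp add: sum_of_monomials)
qed

text \<open>
Sums over the support are compared on a common finite superset; the extra terms vanish. This is what
makes the partial derivative additive.
\<close>

lemma pdiff_superset:
  assumes "finite S" "Poly_Mapping.keys p \<subseteq> S"
  shows "pdiff i p = (\<Sum>e\<in>S. Poly_Mapping.single (e - Poly_Mapping.single i 1)
       (Poly_Mapping.lookup p e * real (Poly_Mapping.lookup e i)))"
  unfolding pdiff_def using assms
  by (intro sum.mono_neutral_left) (auto simp: in_keys_iff)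

lemma pdiff_add: "pdiff i (p + q) = pdiff i p + pdiff i q"
proof -
  let ?S = "Poly_Mapping.keys p \<union> Poly_Mapping.keys q"
  have "Poly_Mapping.keys (p + q) \<subseteq> ?S" by (rule Poly_Mapping.keys_add)
  then show ?thesis
    by (simp add: pdiff_superset[of ?S] lookup_add ring_distribs single_add sum.distrib)
qed

lemma pdiff_scale: "pdiff i (pconst c * p) = pconst c * pdiff i p"
proof -
  have l: "Poly_Mapping.lookup (pconst c * p) e = c * Poly_Mapping.lookup p e" for e
    unfolding pconst_def by (simp flip: mult_map_scale_conv_mult add: Poly_Mapping.map.rep_eq when_def)
  have k: "Poly_Mapping.keys (pconst c * p) \<subseteq> Poly_Mapping.keys p"
    by (auto simp: in_keys_iff l)
  show ?thesis
    by (subst pdiff_superset[OF _ k], simp, unfold l)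
       (simp add: pdiff_def pconst_def sum_distrib_left mult_single mult.assoc)
qed

lemma dot_grad_add: "dot_grad f (p + q) = dot_grad f p + dot_grad f q"
  by (simp add: dot_grad_def pdiff_add ring_distribs sum.distrib)

lemma dot_grad_scale: "dot_grad f (pconst c * p) = pconst c * dot_grad f p"
  by (simp add: dot_grad_def pdiff_scale sum_distrib_left mult.left_commute)

lemma dot_grad_0 [simp]: "dot_grad f 0 = 0"
  by (simp add: dot_grad_def pdiff_def)

lemma dot_grad_sum: "dot_grad f (\<Sum>j\<in>S. p j) = (\<Sum>j\<in>S. dot_grad f (p j))"
  by (induct S rule: infinite_finite_induct) (auto simp: dot_grad_add)

text \<open>
The formal partial derivatives are the analytic ones. The truncated exponent in \<open>pdiff\<close> is harmless since
the corresponding coefficient is zero.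
\<close>

lemma has_derivative_peval:
  "(peval p has_derivative (\<lambda>v. \<Sum>i\<in>UNIV. peval (pdiff i p) x * v $ i)) (at x)"
proof -
  let ?k = "Poly_Mapping.keys p" and ?c = "Poly_Mapping.lookup p"
  have mono: "((\<lambda>x. \<Prod>i\<in>UNIV. (x $ i) ^ Poly_Mapping.lookup e i) has_derivative
      (\<lambda>v. \<Sum>i\<in>UNIV. (of_nat (Poly_Mapping.lookup e i) * v $ i * (x $ i) ^ (Poly_Mapping.lookup e i - 1)) *
          (\<Prod>j\<in>UNIV - {i}. (x $ j) ^ Poly_Mapping.lookup e j))) (at x)" for e :: "'a \<Rightarrow>\<^sub>0 nat"
    by (auto intro!: has_derivative_prod has_derivative_power[where f="\<lambda>x. x $ _", THEN has_derivative_eq_rhs] bounded_linear_imp_has_derivative)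
  have "(peval p has_derivative (\<lambda>v. \<Sum>e\<in>?k. ?c e * (\<Sum>i\<in>UNIV. (of_nat (Poly_Mapping.lookup e i) * v $ i * (x $ i) ^ (Poly_Mapping.lookup e i - 1)) *
          (\<Prod>j\<in>UNIV - {i}. (x $ j) ^ Poly_Mapping.lookup e j)))) (at x)"
    unfolding peval_def[abs_def]
    by (intro has_derivative_sum has_derivative_mult_right mono)
  moreover have "(\<Sum>e\<in>?k. ?c e * (\<Sum>i\<in>UNIV. (of_nat (Poly_Mapping.lookup e i) * v $ i * (x $ i) ^ (Poly_Mapping.lookup e i - 1)) *
          (\<Prod>j\<in>UNIV - {i}. (x $ j) ^ Poly_Mapping.lookup e j))) = (\<Sum>i\<in>UNIV. peval (pdiff i p) x * v $ i)" for v
  proof -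
    have mm: "(\<Prod>j\<in>UNIV. (x $ j) ^ Poly_Mapping.lookup (e - Poly_Mapping.single i 1) j) =
       (x $ i) ^ (Poly_Mapping.lookup e i - 1) * (\<Prod>j\<in>UNIV - {i}. (x $ j) ^ Poly_Mapping.lookup e j)" for e i
    proof -
      have "(\<Prod>j\<in>UNIV - {i}. (x $ j) ^ Poly_Mapping.lookup (e - Poly_Mapping.single i 1) j)
         = (\<Prod>j\<in>UNIV - {i}. (x $ j) ^ Poly_Mapping.lookup e j)"
        by (rule prod.cong) (auto simp: lookup_minus lookup_single when_def)
      then show ?thesis by (subst prod.remove[of _ i]) (auto simp: lookup_minus)
    qed
    show ?thesis
      unfolding pdiff_def peval_sum peval_single mm sum_distrib_left sum_distrib_right
      by (subst sum.swap) (simp add: algebra_simps)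
  qed
  ultimately show ?thesis by simp
qed

lemma continuous_on_peval [continuous_intros]:
  assumes "continuous_on S h" shows "continuous_on S (\<lambda>x. peval p (h x))"
proof -
  have "continuous_on UNIV (peval p)"
    by (meson has_derivative_peval has_derivative_continuous continuous_at_imp_continuous_on)
  then show ?thesis using assms
    by (rule continuous_on_compose2) auto
qed

lemma peval_dot_grad: "peval (dot_grad f p) x = (\<Sum>i\<in>UNIV. peval (pdiff i p) x * field_eval f x $ i)"
  by (simp add: dot_grad_def field_eval_def mult.commute)

text \<open>
The chain rule: \<open>f \<bullet> \<nabla>p\<close> is the rate of change of \<open>p\<close> along a solution. All the dynamics enters
through this identity.
\<close>

lemma peval_along_solution:
  assumes "(z has_vector_derivative field_eval f (z t)) (at t within S)"
  shows "((\<lambda>t. peval p (z t)) has_real_derivative peval (dot_grad f p) (z t)) (at t within S)"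
proof -
  have "((\<lambda>t. peval p (z t)) has_derivative
      (\<lambda>h. \<Sum>i\<in>UNIV. peval (pdiff i p) (z t) * (h *\<^sub>R field_eval f (z t)) $ i)) (at t within S)"
    using has_derivative_compose[OF assms[unfolded has_vector_derivative_def] has_derivative_peval] .
  then show ?thesis
    unfolding has_field_derivative_def peval_dot_grad
    by (rule has_derivative_eq_rhs) (auto simp: sum_distrib_left sum_distrib_right algebra_simps)
qed

lemma real_polynomial_function_peval:
  fixes w :: "real ^ 'n::finite \<Rightarrow> real"
  assumes "real_polynomial_function w"
  shows "\<exists>p. w = peval p"
  using assms
proof induct
  case (linear f)
  have "f x = peval (\<Sum>i\<in>UNIV. pconst (f (axis i 1)) * pvar i) x" for x
  proof -
    have "f x = f (\<Sum>i\<in>UNIV. (x $ i) *\<^sub>R axis i 1)" by (simp add: basis_expansion flip: scalar_mult_eq_scaleR)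
    also have "\<dots> = (\<Sum>i\<in>UNIV. (x $ i) * f (axis i 1))"
      using linear by (simp add: linear_sum linear_cmul bounded_linear.linear)
    finally show ?thesis by (simp add: mult.commute)
  qed
  then show ?case by blast
next
  case (const c) then show ?case by (intro exI[of _ "pconst c"]) (auto simp: fun_eq_iff)
next
  case (add f g) then show ?case by (metis (no_types, lifting) ext peval_add)
next
  case (mult f g) then show ?case by (metis (no_types, lifting) ext peval_mult)
qed

lemma peval_dense:
  fixes w :: "real ^ 'n::finite \<Rightarrow> real"
  assumes "compact K" "continuous_on K w" "0 < e"
  obtains p where "\<And>x. x \<in> K \<Longrightarrow> \<bar>w x - peval p x\<bar> < e"
  using Stone_Weierstrass_real_polynomial_function[OF assms] real_polynomial_function_peval by metis

section \<open>Bernstein expansion and Putinar's Positivstellensatz\<close>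

definition sos :: "'n::finite rpoly set" where
  "sos = {p. \<exists>(k::nat) h. p = (\<Sum>j<k. h j ^ 2)}"

text \<open>
The index 0 is the multiplier of the constant 1, as in \<open>Lambda\<close>, but no degree is bounded.
\<close>

definition qmod :: "nat \<Rightarrow> (nat \<Rightarrow> 'n::finite rpoly) \<Rightarrow> 'n rpoly set" where
  "qmod m g = {\<sigma> 0 + (\<Sum>i=1..m. \<sigma> i * g i) | \<sigma>. \<forall>i\<le>m. \<sigma> i \<in> sos}"

lemma sum_lessThan_append:
  fixes f :: "nat \<Rightarrow> 'a::comm_monoid_add"
  shows "(\<Sum>j<k + l. f j) = (\<Sum>j<k. f j) + (\<Sum>j<l. f (k + j))"
  by (induct l) (auto simp: add.assoc)

lemma sos_0 [simp]: "0 \<in> sos"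
  unfolding sos_def by (auto intro!: exI[of _ "0::nat"])

lemma sos_square [simp]: "h ^ 2 \<in> sos"
  unfolding sos_def by (auto intro!: exI[of _ "1::nat"] exI[of _ "\<lambda>_. h"])

lemma sos_add [intro]:
  assumes "p \<in> sos" "q \<in> sos" shows "p + q \<in> sos"
proof -
  obtain k l :: nat and h h' where p: "p = (\<Sum>j<k. h j ^ 2)" and q: "q = (\<Sum>j<l. h' j ^ 2)"
    using assms unfolding sos_def by blast
  have "p + q = (\<Sum>j<k + l. (if j < k then h j else h' (j - k)) ^ 2)"
    by (simp add: p q sum_lessThan_append)
  then show ?thesis
    unfolding sos_def by (intro CollectI exI[of _ "k + l"] exI[of _ "\<lambda>j. if j < k then h j else h' (j - k)"])
qed

lemma sos_sum [intro]: "(\<And>j. j \<in> S \<Longrightarrow> p j \<in> sos) \<Longrightarrow> (\<Sum>j\<in>S. p j) \<in> sos"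
  by (induct S rule: infinite_finite_induct) auto

lemma sos_mult [intro]:
  assumes "p \<in> sos" "q \<in> sos" shows "p * q \<in> sos"
proof -
  obtain k l :: nat and h h' where p: "p = (\<Sum>j<k. h j ^ 2)" and q: "q = (\<Sum>j<l. h' j ^ 2)"
    using assms unfolding sos_def by blast
  have "p * q = (\<Sum>i<k. \<Sum>j<l. (h i * h' j) ^ 2)"
    by (simp add: p q sum_product power_mult_distrib)
  then show ?thesis by (auto intro!: sos_sum)
qed

lemma sos_pconst [simp]: "0 \<le> c \<Longrightarrow> pconst c \<in> sos"
  using sos_square[of "pconst (sqrt c)"] by (simp flip: pconst_power)

lemma qmod_add [intro]:
  assumes "p \<in> qmod m g" "q \<in> qmod m g" shows "p + q \<in> qmod m g"
proof -
  obtain \<sigma> \<rho> where p: "p = \<sigma> 0 + (\<Sum>i=1..m. \<sigma> i * g i)" "\<forall>i\<le>m. \<sigma> i \<in> sos"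
    and q: "q = \<rho> 0 + (\<Sum>i=1..m. \<rho> i * g i)" "\<forall>i\<le>m. \<rho> i \<in> sos"
    using assms by (auto simp: qmod_def)
  show ?thesis
    unfolding qmod_def using p q
    by (intro CollectI exI[of _ "\<lambda>i. \<sigma> i + \<rho> i"]) (auto simp: distrib_right sum.distrib algebra_simps)
qed

lemma qmod_mult [intro]:
  assumes "s \<in> sos" "p \<in> qmod m g" shows "s * p \<in> qmod m g"
proof -
  obtain \<sigma> where p: "p = \<sigma> 0 + (\<Sum>i=1..m. \<sigma> i * g i)" "\<forall>i\<le>m. \<sigma> i \<in> sos"
    using assms by (auto simp: qmod_def)
  show ?thesis
    unfolding qmod_def using p assms(1)
    by (intro CollectI exI[of _ "\<lambda>i. s * \<sigma> i"]) (auto simp: distrib_left sum_distrib_left mult.assoc)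
qed

lemma qmod_sos [intro]: "s \<in> sos \<Longrightarrow> s \<in> qmod m g"
  unfolding qmod_def by (intro CollectI exI[of _ "\<lambda>i. if i = 0 then s else 0"]) auto

lemma qmod_generator:
  assumes "i \<in> {1..m}" shows "g i \<in> qmod m g"
proof -
  have "(\<Sum>j=1..m. (if j = i then 1 else 0) * g j) = (\<Sum>j=1..m. if j = i then g j else 0)"
    by (rule sum.cong) auto
  then have "(\<Sum>j=1..m. (if j = i then 1 else 0) * g j) = g i" using assms by simp
  then show ?thesis
    unfolding qmod_def using assms sos_square[of 1]
    by (intro CollectI exI[of _ "\<lambda>j. if j = i then 1 else 0"]) auto
qed

lemma qmod_sum [intro]: "(\<And>j. j \<in> S \<Longrightarrow> p j \<in> qmod m g) \<Longrightarrow> (\<Sum>j\<in>S. p j) \<in> qmod m g"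
  by (induct S rule: infinite_finite_induct) auto

text \<open>
The quadratic module of one constraint \<open>L - \<parallel>x\<parallel>\<^sup>2 \<ge> 0\<close>. With a single generator it coincides with the
preordering, so unlike a general quadratic module it is closed under products.
\<close>

definition ball_cone :: "real \<Rightarrow> 'n::finite rpoly set" where
  "ball_cone L = {s + t * (pconst L - norm_sq_poly) | s t. s \<in> sos \<and> t \<in> sos}"

lemma ball_coneI: "s \<in> sos \<Longrightarrow> t \<in> sos \<Longrightarrow> s + t * (pconst L - norm_sq_poly) \<in> ball_cone L"
  unfolding ball_cone_def by blast

lemma ball_cone_sos: "s \<in> sos \<Longrightarrow> s \<in> ball_cone L"
  using ball_coneI[of s 0 L] by simp

lemma ball_cone_add [intro]:
  assumes "p \<in> ball_cone L" "q \<in> ball_cone L" shows "p + q \<in> ball_cone L"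
proof -
  let ?b = "pconst L - norm_sq_poly"
  obtain s t s' t' where *: "p = s + t * ?b" "q = s' + t' * ?b" "s \<in> sos" "t \<in> sos" "s' \<in> sos" "t' \<in> sos"
    using assms unfolding ball_cone_def by blast
  have "p + q = (s + s') + (t + t') * ?b" unfolding * by (simp only: distrib_right ac_simps)
  then show ?thesis using ball_coneI[of "s + s'" "t + t'" L] *(3-) by (simp only:) (simp add: sos_add)
qed

lemma ball_cone_mult [intro]:
  assumes "p \<in> ball_cone L" "q \<in> ball_cone L" shows "p * q \<in> ball_cone L"
proof -
  let ?b = "pconst L - norm_sq_poly"
  obtain s t s' t' where *: "p = s + t * ?b" "q = s' + t' * ?b" "s \<in> sos" "t \<in> sos" "s' \<in> sos" "t' \<in> sos"
    using assms unfolding ball_cone_def by blast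
  have "p * q = (s * s' + t * t' * ?b ^ 2) + (s * t' + t * s') * ?b"
    unfolding * by (simp only: power2_eq_square distrib_right distrib_left ac_simps)
  then show ?thesis using ball_coneI[of "s * s' + t * t' * ?b ^ 2" "s * t' + t * s'" L] *(3-)
    by (simp add: sos_add sos_mult)
qed

lemma ball_cone_sum [intro]: "(\<And>j. j \<in> S \<Longrightarrow> p j \<in> ball_cone L) \<Longrightarrow> (\<Sum>j\<in>S. p j) \<in> ball_cone L"
  by (induct S rule: infinite_finite_induct) (auto intro: ball_cone_sos)

lemma ball_cone_prod [intro]: "(\<And>j. j \<in> S \<Longrightarrow> p j \<in> ball_cone L) \<Longrightarrow> (\<Prod>j\<in>S. p j) \<in> ball_cone L"
  by (induct S rule: infinite_finite_induct) (use sos_square[of 1] in \<open>auto intro: ball_cone_sos\<close>)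

lemma ball_cone_power [intro]: "p \<in> ball_cone L \<Longrightarrow> p ^ k \<in> ball_cone L"
  using ball_cone_prod[of "{..<k}" "\<lambda>_. p"] by simp

lemma ball_cone_subset_qmod:
  assumes "pconst L - norm_sq_poly \<in> qmod m g" shows "ball_cone L \<subseteq> qmod m g"
  unfolding ball_cone_def using assms by blast

text \<open>
The cube of half-width \<open>R\<close> contains the ball, and its faces are certified explicitly: with \<open>y = \<plusminus>x\<^sub>i\<close>,
\<open>2R(R + y) = (R + y)\<^sup>2 + (R\<^sup>2 - L) + (\<Sum>j\<noteq>i. x\<^sub>j\<^sup>2) + (L - \<parallel>x\<parallel>\<^sup>2)\<close>.
\<close>

lemma face_in_ball_cone:
  fixes y :: "'n::finite rpoly"
  assumes R: "0 < R" "L \<le> R\<^sup>2" and y: "y ^ 2 = pvar i ^ 2"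
  shows "pconst (1 / (2 * R)) * (pconst R + y) \<in> ball_cone L"
proof -
  let ?b = "pconst L - norm_sq_poly :: 'n rpoly"
  let ?s = "(pconst R + y) ^ 2 + pconst (R\<^sup>2 - L) + (\<Sum>j\<in>UNIV - {i}. pvar j ^ 2)"
  have "?s \<in> sos" using R by (intro sos_add sos_sum) auto
  moreover have "1 \<in> (sos :: 'n rpoly set)" using sos_square[of 1] by simp
  ultimately have "?s + 1 * ?b \<in> ball_cone L" by (rule ball_coneI)
  moreover have "?s + 1 * ?b = pconst (2 * R) * (pconst R + y)"
  proof -
    have n: "norm_sq_poly = y ^ 2 + (\<Sum>j\<in>UNIV - {i}. pvar j ^ 2)"
      unfolding norm_sq_poly_def by (subst sum.remove[of _ i]) (auto simp: y)
    have two: "pconst (2 * R) = pconst R + pconst R" by (simp flip: pconst_add)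
    show ?thesis
      unfolding n two pconst_diff pconst_power by (simp add: power2_eq_square algebra_simps)
  qed
  moreover have "pconst (1 / (2 * R) * (1 / (2 * R))) \<in> ball_cone L" by (intro ball_cone_sos sos_pconst) simp
  ultimately have "pconst (1 / (2 * R) * (1 / (2 * R))) * (pconst (2 * R) * (pconst R + y)) \<in> ball_cone L"
    by (metis ball_cone_mult)
  then have "pconst (1 / (2 * R) * (1 / (2 * R)) * (2 * R)) * (pconst R + y) \<in> ball_cone L"
    by (simp only: pconst_mult mult.assoc)
  then show ?thesis using R by simp
qed

text \<open>
Multiplying \<open>u^a\<close> by \<open>1 = (u + v)^(N - a)\<close> and regrouping gives its Bernstein coefficients of degree \<open>N\<close>.
They are close to \<open>(j / N)^a\<close>, the values at the nodes, by the next lemma.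
\<close>

lemma coordinate_power_expansion:
  fixes u v :: "'n::finite rpoly"
  assumes uv: "u + v = 1" and a: "a \<le> N"
  shows "u ^ a = (\<Sum>j\<le>N. pconst (real (j choose a) / real (N choose a)) *
     (pconst (real (N choose j)) * u ^ j * v ^ (N - j)))"
proof -
  have "u ^ a = u ^ a * (u + v) ^ (N - a)" by (simp add: uv)
  also have "\<dots> = (\<Sum>l\<le>N - a. of_nat ((N - a) choose l) * u ^ (l + a) * v ^ (N - (l + a)))"
    by (simp add: binomial_ring sum_distrib_left power_add mult_ac add.commute[of a])
  also have "\<dots> = (\<Sum>j\<in>{a..N}. of_nat ((N - a) choose (j - a)) * u ^ j * v ^ (N - j))"
    by (rule sum.reindex_bij_witness[of _ "\<lambda>j. j - a" "\<lambda>l. l + a"]) (use a in auto)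
  also have "\<dots> = (\<Sum>j\<in>{a..N}. pconst (real (j choose a) / real (N choose a)) *
     (pconst (real (N choose j)) * u ^ j * v ^ (N - j)))"
  proof (rule sum.cong[OF refl])
    fix j assume j: "j \<in> {a..N}"
    have "real (N choose j) * real (j choose a) = real (N choose a) * real ((N - a) choose (j - a))"
      using choose_mult[of a j N] j by (metis atLeastAtMost_iff of_nat_mult)
    then have "real (j choose a) / real (N choose a) * real (N choose j) = real ((N - a) choose (j - a))"
      using a by (simp add: field_simps)
    moreover have "pconst (real k) = (of_nat k :: 'n rpoly)" for k by (simp add: pconst_def)
    ultimately have "of_nat ((N - a) choose (j - a)) = (pconst (real (j choose a) / real (N choose a)) * pconst (real (N choose j)) :: 'n rpoly)"
      by (metis pconst_mult)
    then show "of_nat ((N - a) choose (j - a)) * u ^ j * v ^ (N - j) = pconst (real (j choose a) / real (N choose a)) *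
     (pconst (real (N choose j)) * u ^ j * v ^ (N - j))" by (simp add: mult.assoc)
  qed
  also have "\<dots> = (\<Sum>j\<le>N. pconst (real (j choose a) / real (N choose a)) *
     (pconst (real (N choose j)) * u ^ j * v ^ (N - j)))"
    by (rule sum.mono_neutral_left) (auto simp: binomial_eq_0 not_le)
  finally show ?thesis .
qed

text \<open>
Both sides are products of \<open>a\<close> factors, \<open>(j - t) / (N - t)\<close> and \<open>j / N\<close>, of modulus at most 1 and
close to each other. For \<open>j < a\<close> the first product contains the factor zero, in accordance with the
vanishing binomial coefficient.
\<close>

lemma choose_ratio_approx:
  assumes N: "2 * a \<le> N" "0 < N" and j: "j \<le> N"
  shows "\<bar>real (j choose a) / real (N choose a) - (real j / real N) ^ a\<bar> \<le> 2 * real a ^ 2 / real N"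
    and "\<bar>real (j choose a) / real (N choose a)\<bar> \<le> 1"
proof -
  have ch: "real (k choose a) = (\<Prod>t<a. real k - real t) / fact a" for k
    by (simp add: binomial_gbinomial gbinomial_prod_rev atLeast0LessThan)
  have eq: "real (j choose a) / real (N choose a) = (\<Prod>t<a. (real j - real t) / (real N - real t))"
    unfolding ch by (simp add: prod_dividef)
  have le1: "norm ((real j - real t) / (real N - real t)) \<le> 1" if "t < a" for t
  proof -
    \<comment> \<open>for \<open>j < t\<close> the factor is negative; it is then at least -1 because \<open>2 a \<le> N\<close>\<close>
    have "\<bar>real j - real t\<bar> \<le> real N - real t" using N j that by (simp add: abs_le_iff)
    moreover have "0 < real N - real t" using N that by simp
    ultimately show ?thesis by simp
  qed
  show "\<bar>real (j choose a) / real (N choose a)\<bar> \<le> 1"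
    unfolding eq abs_prod using le1 by (intro prod_le_1) auto
  have "norm ((\<Prod>t<a. (real j - real t) / (real N - real t)) - (\<Prod>t<a. real j / real N)) \<le>
     (\<Sum>t<a. norm ((real j - real t) / (real N - real t) - real j / real N))"
    by (intro norm_prod_diff) (use le1 N j in auto)
  also have "\<dots> \<le> (\<Sum>t<a. 2 * real a / real N)"
  proof (rule sum_mono)
    fix t assume "t \<in> {..<a}"
    then have t: "t < a" by simp
    have p: "0 < real N - real t" "0 < real N" using N t by auto
    have "(real j - real t) / (real N - real t) - real j / real N = - (real t * (real N - real j) / ((real N - real t) * real N))"
      using p by (simp add: field_simps)
    then have "norm ((real j - real t) / (real N - real t) - real j / real N) = real t * (real N - real j) / ((real N - real t) * real N)"
      using p j by simp
    also have "\<dots> \<le> real a * real N / ((real N / 2) * real N)"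
      using p t N j by (intro frac_le mult_mono) auto
    also have "\<dots> = 2 * real a / real N" using p by (simp add: field_simps)
    finally show "norm ((real j - real t) / (real N - real t) - real j / real N) \<le> 2 * real a / real N" .
  qed
  also have "\<dots> = 2 * real a ^ 2 / real N" by (simp add: power2_eq_square)
  finally show "\<bar>real (j choose a) / real (N choose a) - (real j / real N) ^ a\<bar> \<le> 2 * real a ^ 2 / real N"
    by (simp add: eq)
qed

text \<open>
With its complement \<open>unit_cocoord\<close> below, the coordinate that maps the interval \<open>[-R, R]\<close> to \<open>[0, 1]\<close>;
the two add up to 1 and are nonnegative on the cube.
\<close>

definition unit_coord :: "real \<Rightarrow> 'n::finite \<Rightarrow> 'n rpoly" where
  "unit_coord R i = pconst (1 / (2 * R)) * (pconst R + pvar i)"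

definition unit_cocoord :: "real \<Rightarrow> 'n::finite \<Rightarrow> 'n rpoly" where
  "unit_cocoord R i = pconst (1 / (2 * R)) * (pconst R + - pvar i)"

lemma unit_coord_sum: "0 < R \<Longrightarrow> unit_coord R i + unit_cocoord R i = 1"
proof -
  assume R: "0 < R"
  have "unit_coord R i + unit_cocoord R i = pconst (1 / (2 * R)) * (pconst R + pconst R)"
    unfolding unit_coord_def unit_cocoord_def by (simp add: algebra_simps)
  also have "\<dots> = pconst 1" using R by (simp flip: pconst_add pconst_mult)
  finally show ?thesis by (simp add: pconst_1)
qed

text \<open>
Every polynomial is a sum of monomials in the rescaled coordinates, since such sums form a ring that
contains the constants and the variables.
\<close>

lemma unit_coord_induct:
  fixes p :: "'n::finite rpoly"
  assumes R: "0 < R"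
    and mono: "\<And>c \<alpha>. P (pconst c * (\<Prod>i\<in>UNIV. unit_coord R i ^ \<alpha> i))"
    and add: "\<And>p q. P p \<Longrightarrow> P q \<Longrightarrow> P (p + q)"
  shows "P p"
proof -
  define mon :: "real \<Rightarrow> ('n \<Rightarrow> nat) \<Rightarrow> 'n rpoly" where "mon c \<alpha> = pconst c * (\<Prod>i\<in>UNIV. unit_coord R i ^ \<alpha> i)" for c \<alpha>
  define S where "S p \<longleftrightarrow> (\<exists>(k::nat) c \<alpha>. p = (\<Sum>j<k. mon (c j) (\<alpha> j)))" for p
  have Sadd: "S (p + q)" if pq: "S p" "S q" for p q
  proof -
    obtain k l :: nat and c \<alpha> d \<beta> where "p = (\<Sum>j<k. mon (c j) (\<alpha> j))" "q = (\<Sum>j<l. mon (d j) (\<beta> j))"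
      using pq unfolding S_def by blast
    then have "p + q = (\<Sum>j<k + l. mon (if j < k then c j else d (j - k)) (if j < k then \<alpha> j else \<beta> (j - k)))"
      by (simp add: sum_lessThan_append)
    then show ?thesis unfolding S_def by (intro exI[of _ "k + l"] exI[of _ "\<lambda>j. if j < k then c j else d (j - k)"]
       exI[of _ "\<lambda>j. if j < k then \<alpha> j else \<beta> (j - k)"]) auto
  qed
  have Smon: "S (mon c \<alpha>)" for c \<alpha>
    unfolding S_def by (intro exI[of _ "1::nat"] exI[of _ "\<lambda>_. c"] exI[of _ "\<lambda>_. \<alpha>"]) simp
  have S0: "S 0" using Smon[of 0] by (simp add: mon_def)
  have Ssum: "S (\<Sum>j\<in>J. h j)" if "\<And>j. j \<in> J \<Longrightarrow> S (h j)" for J :: "nat set" and h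
    using that by (induct J rule: infinite_finite_induct) (auto intro: Sadd S0)
  have mm: "mon c \<alpha> * mon d \<beta> = mon (c * d) (\<lambda>i. \<alpha> i + \<beta> i)" for c d \<alpha> \<beta>
    by (simp add: mon_def pconst_mult power_add prod.distrib mult_ac)
  have "S p"
  proof (induct p rule: rpoly_induct)
    case (const c)
    show ?case using Smon[of c "\<lambda>_. 0"] by (simp add: mon_def)
  next
    case (var i)
    have "(\<Prod>j\<in>UNIV. unit_coord R j ^ (if j = i then 1 else 0)) = (\<Prod>j\<in>UNIV. if j = i then unit_coord R j else 1)"
      by (rule prod.cong) auto
    then have "mon (2 * R) (\<lambda>j. if j = i then 1 else 0) = pconst (2 * R) * unit_coord R i"
      by (simp add: mon_def)
    also have "\<dots> = pconst (2 * R * (1 / (2 * R))) * (pconst R + pvar i)"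
      unfolding unit_coord_def pconst_mult by (simp only: mult.assoc)
    also have "\<dots> = pconst R + pvar i" using R by (simp add: pconst_1)
    finally have "pvar i = mon (2 * R) (\<lambda>j. if j = i then 1 else 0) + mon (- R) (\<lambda>_. 0)"
      by (simp add: mon_def pconst_def single_uminus)
    then show ?case using Sadd Smon by metis
  next
    case (add p q) then show ?case by (rule Sadd)
  next
    case (mult p q)
    then obtain k l :: nat and c \<alpha> d \<beta> where "p = (\<Sum>j<k. mon (c j) (\<alpha> j))" "q = (\<Sum>j<l. mon (d j) (\<beta> j))"
      unfolding S_def by blast
    then have "p * q = (\<Sum>i<k. \<Sum>j<l. mon (c i * d j) (\<lambda>t. \<alpha> i t + \<beta> j t))"
      by (simp add: sum_product mm)
    then show ?case by (auto intro!: Ssum Smon)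
  qed
  then obtain k c \<alpha> where "p = (\<Sum>j<(k::nat). mon (c j) (\<alpha> j))" by (auto simp: S_def)
  moreover have P0: "P 0" using mono[of 0] by simp
  have Pm: "P (mon c \<alpha>)" for c \<alpha> unfolding mon_def by (rule mono)
  have "P (\<Sum>j<k. mon (c j) (\<alpha> j))" for k :: nat
    by (induct k) (auto intro: add P0 Pm)
  ultimately show ?thesis by simp
qed

definition bernstein_node :: "real \<Rightarrow> nat \<Rightarrow> ('n::finite \<Rightarrow> nat) \<Rightarrow> real ^ 'n" where
  "bernstein_node R N j = (\<chi> i. R * (2 * real (j i) / real N - 1))"

definition bernstein_basis :: "real \<Rightarrow> nat \<Rightarrow> ('n::finite \<Rightarrow> nat) \<Rightarrow> 'n rpoly" where
  "bernstein_basis R N j = (\<Prod>i\<in>UNIV. pconst (real (N choose j i)) * unit_coord R i ^ j i * unit_cocoord R i ^ (N - j i))"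

text \<open>
The coefficients of the degree-\<open>N\<close> Bernstein expansion converge uniformly to the values at the grid
points. The expansion is an identity of polynomials, so positivity of the values turns into an algebraic
certificate.
\<close>

lemma bernstein_expansion:
  fixes p :: "'n::finite rpoly"
  assumes R: "0 < R" and e: "0 < e"
  shows "\<exists>N0. \<forall>N\<ge>N0. \<exists>b. p = (\<Sum>j\<in>PiE UNIV (\<lambda>_. {..N}). pconst (b j) * bernstein_basis R N j) \<and>
     (\<forall>j\<in>PiE UNIV (\<lambda>_. {..N}). \<bar>b j - peval p (bernstein_node R N j)\<bar> \<le> e)"
  using e
proof (induct p arbitrary: e rule: unit_coord_induct[OF R])
  case (1 c \<alpha>)
  define A where "A = (\<Sum>i\<in>UNIV. 2 * real (\<alpha> i) ^ 2)"
  define N0 where "N0 = Suc (2 * (\<Sum>i\<in>UNIV. \<alpha> i)) + nat \<lceil>\<bar>c\<bar> * A / e\<rceil>"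
  have "\<exists>b. pconst c * (\<Prod>i\<in>UNIV. unit_coord R i ^ \<alpha> i) = (\<Sum>j\<in>PiE UNIV (\<lambda>_. {..N}). pconst (b j) * bernstein_basis R N j) \<and>
     (\<forall>j\<in>PiE UNIV (\<lambda>_. {..N}). \<bar>b j - peval (pconst c * (\<Prod>i\<in>UNIV. unit_coord R i ^ \<alpha> i)) (bernstein_node R N j)\<bar> \<le> e)"
    if N: "N0 \<le> N" for N
  proof -
    have a: "2 * \<alpha> i \<le> N" for i
      using member_le_sum[of i UNIV \<alpha>] N by (simp add: N0_def)
    have a': "\<alpha> i \<le> N" for i using a[of i] by simp
    have N1: "0 < N" using N by (simp add: N0_def)
    have "\<bar>c\<bar> * A / e \<le> real N" using N unfolding N0_def by linarith
    then have cA: "\<bar>c\<bar> * (A / real N) \<le> e" using N1 1 by (simp add: field_simps)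
    define r where "r i k = real (k choose \<alpha> i) / real (N choose \<alpha> i)" for i k
    have "(\<Prod>i\<in>UNIV. unit_coord R i ^ \<alpha> i) = (\<Prod>i\<in>UNIV. \<Sum>k\<le>N. pconst (r i k) *
       (pconst (real (N choose k)) * unit_coord R i ^ k * unit_cocoord R i ^ (N - k)))"
      unfolding r_def using a by (intro prod.cong refl coordinate_power_expansion unit_coord_sum R a')
    also have "\<dots> = (\<Sum>j\<in>PiE UNIV (\<lambda>_. {..N}). \<Prod>i\<in>UNIV. pconst (r i (j i)) *
       (pconst (real (N choose j i)) * unit_coord R i ^ j i * unit_cocoord R i ^ (N - j i)))"
      by (intro prod_sum_PiE) auto
    also have "\<dots> = (\<Sum>j\<in>PiE UNIV (\<lambda>_. {..N}). (\<Prod>i\<in>UNIV. pconst (r i (j i))) * bernstein_basis R N j)"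
      by (simp add: bernstein_basis_def prod.distrib)
    finally have E: "(\<Prod>i\<in>UNIV. unit_coord R i ^ \<alpha> i) = (\<Sum>j\<in>PiE UNIV (\<lambda>_. {..N}). (\<Prod>i\<in>UNIV. pconst (r i (j i))) * bernstein_basis R N j)" .
    have exp: "pconst c * (\<Prod>i\<in>UNIV. unit_coord R i ^ \<alpha> i) =
       (\<Sum>j\<in>PiE UNIV (\<lambda>_. {..N}). pconst (c * (\<Prod>i\<in>UNIV. r i (j i))) * bernstein_basis R N j)"
    proof -
      have "(\<Prod>i\<in>S. pconst (q i)) = (pconst (\<Prod>i\<in>S. q i) :: 'n rpoly)" for q and S :: "'n set"
        by (induct S rule: infinite_finite_induct) (auto simp: pconst_1 pconst_mult)
      then show ?thesis unfolding E by (simp add: pconst_mult sum_distrib_left mult.assoc)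
    qed
    have "\<bar>c * (\<Prod>i\<in>UNIV. r i (j i)) - peval (pconst c * (\<Prod>i\<in>UNIV. unit_coord R i ^ \<alpha> i)) (bernstein_node R N j)\<bar> \<le> e"
      if j: "j \<in> PiE UNIV (\<lambda>_. {..N})" for j
    proof -
      have jN: "j i \<le> N" for i using j by auto
      have "peval (unit_coord R i) (bernstein_node R N j) = real (j i) / real N" for i
        using R N1 by (simp add: unit_coord_def bernstein_node_def field_simps)
      then have ev: "peval (pconst c * (\<Prod>i\<in>UNIV. unit_coord R i ^ \<alpha> i)) (bernstein_node R N j) = c * (\<Prod>i\<in>UNIV. (real (j i) / real N) ^ \<alpha> i)"
        by simp
      have "norm ((\<Prod>i\<in>UNIV. r i (j i)) - (\<Prod>i\<in>UNIV. (real (j i) / real N) ^ \<alpha> i))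
         \<le> (\<Sum>i\<in>UNIV. norm (r i (j i) - (real (j i) / real N) ^ \<alpha> i))"
      proof (rule norm_prod_diff)
        fix i show "norm (r i (j i)) \<le> 1"
          using choose_ratio_approx(2)[OF a N1 jN] by (simp add: r_def)
        show "norm ((real (j i) / real N) ^ \<alpha> i) \<le> 1"
          using jN[of i] N1 by (simp add: power_le_one)
      qed
      also have "\<dots> \<le> (\<Sum>i\<in>UNIV. 2 * real (\<alpha> i) ^ 2 / real N)"
        using choose_ratio_approx(1)[OF a N1 jN] by (intro sum_mono) (simp add: r_def)
      also have "\<dots> = A / real N" by (simp add: A_def sum_divide_distrib)
      finally have "\<bar>c\<bar> * \<bar>(\<Prod>i\<in>UNIV. r i (j i)) - (\<Prod>i\<in>UNIV. (real (j i) / real N) ^ \<alpha> i)\<bar> \<le> \<bar>c\<bar> * (A / real N)"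
        by (intro mult_left_mono) auto
      then show ?thesis using cA unfolding ev right_diff_distrib[symmetric] abs_mult by linarith
    qed
    then show ?thesis using exp by (intro exI[of _ "\<lambda>j. c * (\<Prod>i\<in>UNIV. r i (j i))"] conjI ballI)
  qed
  then show ?case by blast
next
  case (2 p q)
  from 2(3) have "0 < e / 2" by simp
  from 2(1)[OF this] 2(2)[OF this] obtain N1 N2 where
    *: "\<And>N. N1 \<le> N \<Longrightarrow> \<exists>b. p = (\<Sum>j\<in>PiE UNIV (\<lambda>_. {..N}). pconst (b j) * bernstein_basis R N j) \<and>
     (\<forall>j\<in>PiE UNIV (\<lambda>_. {..N}). \<bar>b j - peval p (bernstein_node R N j)\<bar> \<le> e / 2)"
    "\<And>N. N2 \<le> N \<Longrightarrow> \<exists>b. q = (\<Sum>j\<in>PiE UNIV (\<lambda>_. {..N}). pconst (b j) * bernstein_basis R N j) \<and>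
     (\<forall>j\<in>PiE UNIV (\<lambda>_. {..N}). \<bar>b j - peval q (bernstein_node R N j)\<bar> \<le> e / 2)" by blast
  have "\<exists>b. p + q = (\<Sum>j\<in>PiE UNIV (\<lambda>_. {..N}). pconst (b j) * bernstein_basis R N j) \<and>
     (\<forall>j\<in>PiE UNIV (\<lambda>_. {..N}). \<bar>b j - peval (p + q) (bernstein_node R N j)\<bar> \<le> e)" if N: "max N1 N2 \<le> N" for N
  proof -
    obtain b b' where "p = (\<Sum>j\<in>PiE UNIV (\<lambda>_. {..N}). pconst (b j) * bernstein_basis R N j)"
      "q = (\<Sum>j\<in>PiE UNIV (\<lambda>_. {..N}). pconst (b' j) * bernstein_basis R N j)"
      and bb: "\<And>j. j\<in>PiE UNIV (\<lambda>_. {..N}) \<Longrightarrow> \<bar>b j - peval p (bernstein_node R N j)\<bar> \<le> e / 2"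
      "\<And>j. j\<in>PiE UNIV (\<lambda>_. {..N}) \<Longrightarrow> \<bar>b' j - peval q (bernstein_node R N j)\<bar> \<le> e / 2"
      using *(1)[of N] *(2)[of N] N by auto
    then have "p + q = (\<Sum>j\<in>PiE UNIV (\<lambda>_. {..N}). pconst (b j + b' j) * bernstein_basis R N j)"
      by (simp add: pconst_add distrib_right sum.distrib)
    moreover have "\<bar>(b j + b' j) - peval (p + q) (bernstein_node R N j)\<bar> \<le> e" if "j\<in>PiE UNIV (\<lambda>_. {..N})" for j
      using bb(1)[OF that] bb(2)[OF that] unfolding peval_add by linarith
    ultimately show ?thesis by (intro exI[of _ "\<lambda>j. b j + b' j"] conjI ballI)
  qed
  then show ?case by blast
qed

definition cube :: "real \<Rightarrow> (real ^ 'n::finite) set" where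
  "cube R = {x. \<forall>i. \<bar>x $ i\<bar> \<le> R}"

lemma compact_cube: "compact (cube R :: (real ^ 'n::finite) set)"
proof -
  have "(cube R :: (real ^ 'n) set) = cbox (\<chi> i. - R) (\<chi> i. R)"
  proof (rule set_eqI)
    fix x :: "real ^ 'n"
    have "\<bar>x $ i\<bar> \<le> R \<longleftrightarrow> - R \<le> x $ i \<and> x $ i \<le> R" for i by linarith
    then show "x \<in> cube R \<longleftrightarrow> x \<in> cbox (\<chi> i. - R) (\<chi> i. R)"
      unfolding cube_def mem_box_cart vec_lambda_beta mem_Collect_eq by presburger
  qed
  then show ?thesis by (metis compact_cbox)
qed

text \<open>
For large \<open>N\<close> the Bernstein coefficients differ from values on the cube by at most the minimum of \<open>q\<close>
there, hence are nonnegative, and the basis polynomials are products of the face polynomials.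
\<close>

lemma positive_on_cube_in_ball_cone:
  fixes q :: "'n::finite rpoly"
  assumes R: "0 < R" "L \<le> R\<^sup>2" and pos: "\<And>x. x \<in> cube R \<Longrightarrow> 0 < peval q x"
  shows "q \<in> ball_cone L"
proof -
  have "(0 :: real ^ 'n) \<in> cube R" using R by (simp add: cube_def)
  then have "(cube R :: (real ^ 'n) set) \<noteq> {}" by blast
  then obtain x0 where x0: "x0 \<in> cube R" "\<And>x. x \<in> cube R \<Longrightarrow> peval q x0 \<le> peval q x"
    using continuous_attains_inf[OF compact_cube _ continuous_on_peval[OF continuous_on_id]] by blast
  from bernstein_expansion[OF R(1) pos[OF x0(1)], of q]
  obtain N where N: "\<forall>M\<ge>N. \<exists>b. q = (\<Sum>j\<in>PiE UNIV (\<lambda>_. {..M}). pconst (b j) * bernstein_basis R M j) \<and>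
     (\<forall>j\<in>PiE UNIV (\<lambda>_. {..M}). \<bar>b j - peval q (bernstein_node R M j)\<bar> \<le> peval q x0)" ..
  from N[rule_format, OF order_refl]
  obtain b where b: "q = (\<Sum>j\<in>PiE UNIV (\<lambda>_. {..N}). pconst (b j) * bernstein_basis R N j)"
     "\<forall>j\<in>PiE UNIV (\<lambda>_. {..N}). \<bar>b j - peval q (bernstein_node R N j)\<bar> \<le> peval q x0"
    by (elim exE conjE)
  have uv: "unit_coord R i \<in> ball_cone L" "unit_cocoord R i \<in> ball_cone L" for i :: 'n
    unfolding unit_coord_def unit_cocoord_def by (rule face_in_ball_cone[OF R refl]) (rule face_in_ball_cone[OF R power2_minus])
  have "pconst (b j) * bernstein_basis R N j \<in> ball_cone L" if j: "j\<in>PiE UNIV (\<lambda>_. {..N})" for j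
  proof -
    have "\<bar>R * (2 * real (j i) / real N - 1)\<bar> \<le> R" for i
    proof -
      have "j i \<le> N" using j by auto
      then have "0 \<le> real (j i) / real N" "real (j i) / real N \<le> 1" by (auto simp: divide_le_eq_1)
      then have "\<bar>2 * real (j i) / real N - 1\<bar> \<le> 1" unfolding times_divide_eq_right[symmetric] by linarith
      then have "R * \<bar>2 * real (j i) / real N - 1\<bar> \<le> R * 1" using R by (intro mult_left_mono) auto
      then show ?thesis using R by (simp add: abs_mult)
    qed
    then have "bernstein_node R N j \<in> cube R" by (simp add: cube_def bernstein_node_def)
    from x0(2)[OF this] have "0 \<le> b j" using b(2)[rule_format, OF j] by linarith
    then show ?thesis
      unfolding bernstein_basis_def
      by (intro ball_cone_mult ball_cone_prod ball_cone_power ball_cone_sos[OF sos_pconst] uv of_nat_0_le_iff)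
  qed
  then show ?thesis by (subst b(1)) (rule ball_cone_sum)
qed

text \<open>
As \<open>k\<close> grows, the function \<open>t \<mapsto> (1 - t)^(2k) t\<close> becomes small on \<open>[0, 1]\<close>, while it is at most \<open>t\<close> for
negative \<open>t\<close>. A multiple of it in \<open>t = g i\<close> therefore distinguishes the sign of \<open>g i\<close>, and it is a square
times \<open>g i\<close>.
\<close>

lemma penalty_bound:
  fixes t :: real
  assumes "t \<le> 1" "0 < k"
  shows "(1 - t) ^ (2 * k) * t \<le> 1 / real (2 * k)"
proof (cases "0 \<le> t")
  case True
  have "1 + real (2 * k) * t \<le> (1 + t) ^ (2 * k)" by (rule Bernoulli_inequality) (use True in simp)
  then have "(1 - t) ^ (2 * k) * (1 + real (2 * k) * t) \<le> (1 - t) ^ (2 * k) * (1 + t) ^ (2 * k)"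
    using assms by (intro mult_left_mono) auto
  also have "\<dots> = ((1 - t) * (1 + t)) ^ (2 * k)" by (rule power_mult_distrib[symmetric])
  also have "(1 - t) * (1 + t) = 1 - t\<^sup>2" by (simp add: power2_eq_square algebra_simps)
  also have "(1 - t\<^sup>2) ^ (2 * k) \<le> 1"
  proof (rule power_le_one)
    show "0 \<le> 1 - t\<^sup>2" using True assms by (simp add: power_le_one)
    show "1 - t\<^sup>2 \<le> 1" by simp
  qed
  finally have "(1 - t) ^ (2 * k) + (1 - t) ^ (2 * k) * (real (2 * k) * t) \<le> 1"
    by (simp only: distrib_left mult_1_right)
  moreover have "0 \<le> (1 - t) ^ (2 * k)" by simp
  ultimately have "(1 - t) ^ (2 * k) * (real (2 * k) * t) \<le> 1" by linarith
  then show ?thesis using assms by (simp add: field_simps)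
next
  case False
  then have "(1 - t) ^ (2 * k) * t \<le> 0" by (intro mult_nonneg_nonpos) auto
  then show ?thesis by (rule order_trans) simp
qed

text \<open>
Subtracting \<open>c\<close> times the penalty sum leaves a polynomial that is positive on the whole cube: where some
constraint is violated by a fixed amount the penalty dominates, and elsewhere \<open>q\<close> is bounded below and the
penalty is negligible. The cube is taken large enough to contain the ball of the Archimedean constraint.
\<close>

theorem putinar:
  fixes q :: "'n::finite rpoly"
  assumes arch: "pconst L - norm_sq_poly \<in> qmod m g"
    and pos: "\<And>x. x \<in> semialg_set m g \<Longrightarrow> 0 < peval q x"
  shows "q \<in> qmod m g"
proof -
  define R where "R = max 1 L"
  have R: "0 < R" "L \<le> R\<^sup>2"
  proof -
    have "R * 1 \<le> R * R" unfolding R_def by (intro mult_left_mono) auto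
    moreover have "L \<le> R" by (simp add: R_def)
    ultimately show "L \<le> R\<^sup>2" by (simp add: power2_eq_square)
  qed (simp add: R_def)
  let ?C = "cube R :: (real ^ 'n) set"
  have "\<exists>G. \<forall>x\<in>?C. \<bar>peval p x\<bar> \<le> G" for p :: "'n rpoly"
  proof -
    have "bounded (peval p ` ?C)"
      by (intro compact_imp_bounded compact_continuous_image compact_cube continuous_intros)
    then show ?thesis by (auto simp: bounded_iff)
  qed
  then obtain bd where bd: "\<And>p x. x \<in> ?C \<Longrightarrow> \<bar>peval p x\<bar> \<le> bd p" by metis
  define \<gamma> where "\<gamma> = (\<Sum>i=1..m. \<bar>bd (g i)\<bar>) + 1"
  have \<gamma>: "0 < \<gamma>" unfolding \<gamma>_def by (simp add: add_nonneg_pos sum_nonneg)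
  \<comment> \<open>the scaling makes every constraint at most 1 on the cube, as \<open>penalty_bound\<close> requires\<close>
  define h where "h i = pconst (1 / \<gamma>) * g i" for i
  have ph: "peval (h i) x = peval (g i) x / \<gamma>" for i x by (simp add: h_def)
  have h1: "peval (h i) x \<le> 1" if "x \<in> ?C" "i \<in> {1..m}" for i x
  proof -
    have "\<bar>bd (g i)\<bar> \<le> (\<Sum>i=1..m. \<bar>bd (g i)\<bar>)" using that(2) by (intro member_le_sum) auto
    then have "peval (g i) x \<le> \<gamma>" using bd[OF that(1), of "g i"] unfolding \<gamma>_def by linarith
    then show ?thesis using \<gamma> by (simp add: ph)
  qed
  \<comment> \<open>\<open>w\<close> is positive everywhere: each point either lies in the set, where \<open>q\<close> is positive, or violates a constraint\<close>
  define w where "w x = max (peval q x) 0 + (\<Sum>i=1..m. max (- peval (h i) x) 0)" for x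
  have wpos: "0 < w x" for x
  proof (cases "x \<in> semialg_set m g")
    case True
    then have "0 < max (peval q x) 0" using pos by simp
    then show ?thesis unfolding w_def by (simp add: add_pos_nonneg sum_nonneg)
  next
    case False
    then obtain i where i: "i \<in> {1..m}" "peval (g i) x < 0" by (auto simp: semialg_set_def not_le)
    then have "0 < max (- peval (h i) x) 0" using \<gamma> by (simp add: ph field_simps)
    also have "\<dots> \<le> (\<Sum>i=1..m. max (- peval (h i) x) 0)"
      using i by (intro member_le_sum[of i "{1..m}" "\<lambda>i. max (- peval (h i) x) 0"]) auto
    finally show ?thesis unfolding w_def by (simp add: add_nonneg_pos)
  qed
  have "(0 :: real ^ 'n) \<in> ?C" using R by (simp add: cube_def)
  then have "?C \<noteq> {}" by blast
  moreover have "continuous_on ?C w" unfolding w_def[abs_def] by (intro continuous_intros)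
  ultimately obtain x0 where x0: "\<And>x. x \<in> ?C \<Longrightarrow> w x0 \<le> w x"
    using continuous_attains_inf[OF compact_cube, of R w] by auto
  define \<mu> where "\<mu> = w x0 / real (m + 2)"
  have \<mu>: "0 < \<mu>" using wpos by (simp add: \<mu>_def)
  have alt: "\<mu> \<le> peval q x \<or> (\<exists>i\<in>{1..m}. peval (h i) x \<le> - \<mu>)" if "x \<in> ?C" for x
  proof (rule ccontr)
    assume no: "\<not> ?thesis"
    have "max (- peval (h i) x) 0 \<le> \<mu>" if "i \<in> {1..m}" for i
    proof -
      have "\<not> peval (h i) x \<le> - \<mu>" using no that by blast
      then show ?thesis using \<mu> by simp
    qed
    moreover have "max (peval q x) 0 \<le> \<mu>" using no \<mu> by simp
    ultimately have "w x \<le> \<mu> + (\<Sum>i=1..m. \<mu>)" unfolding w_def by (intro add_mono sum_mono)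
    also have "\<dots> < \<mu> * real (m + 2)" using \<mu> by (simp add: distrib_left mult.commute)
    also have "\<dots> = w x0" by (simp add: \<mu>_def)
    finally show False using x0[OF that] by simp
  qed
  \<comment> \<open>\<open>c \<mu> / 2\<close> exceeds any value of \<open>- q\<close> on the cube; \<open>B\<close> bounds the sum of all small penalty terms\<close>
  define c where "c = 2 * (\<bar>bd q\<bar> + 1) / \<mu>"
  have c: "0 < c" using \<mu> by (simp add: c_def)
  define B where "B = min (\<mu> / 2) (\<mu> / (2 * c))"
  have B: "0 < B" using \<mu> c by (simp add: B_def)
  define k where "k = Suc (nat \<lceil>real m / B\<rceil>)"
  have k: "0 < k" "real m / real (2 * k) \<le> B"
  proof -
    have "real m / B \<le> real (nat \<lceil>real m / B\<rceil>)" by (rule real_nat_ceiling_ge)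
    then have "real m / B \<le> real (2 * k)" unfolding k_def by simp
    then have "real m \<le> real (2 * k) * B" by (simp only: pos_divide_le_eq[OF B])
    moreover have "0 < real (2 * k)" by (simp add: k_def)
    ultimately show "real m / real (2 * k) \<le> B" by (simp only: pos_divide_le_eq mult.commute)
  qed (simp add: k_def)
  define s where "s = (\<Sum>i=1..m. (1 - h i) ^ (2 * k) * h i)"
  have ps: "peval s x = (\<Sum>i=1..m. (1 - peval (h i) x) ^ (2 * k) * peval (h i) x)" for x
    by (simp add: s_def)
  have "q - pconst c * s \<in> ball_cone L"
  proof (rule positive_on_cube_in_ball_cone[OF R])
    fix x assume x: "x \<in> ?C"
    let ?t = "\<lambda>i. (1 - peval (h i) x) ^ (2 * k) * peval (h i) x"
    have le: "?t i \<le> 1 / real (2 * k)" if "i \<in> {1..m}" for i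
      using penalty_bound[OF h1[OF x that] k(1)] .
    show "0 < peval (q - pconst c * s) x"
    proof (cases "\<mu> \<le> peval q x")
      case True
      have "peval s x \<le> (\<Sum>i=1..m. 1 / real (2 * k))" unfolding ps by (intro sum_mono le)
      also have "\<dots> \<le> B" using k by simp
      also have "\<dots> \<le> \<mu> / (2 * c)" by (simp add: B_def)
      finally have "c * peval s x \<le> c * (\<mu> / (2 * c))" using c by (intro mult_left_mono) auto
      then have "c * peval s x \<le> \<mu> / 2" using c by simp
      then show ?thesis using True \<mu> by simp
    next
      case False
      then obtain i where i: "i \<in> {1..m}" "peval (h i) x \<le> - \<mu>" using alt[OF x] by blast
      have "1 \<le> (1 - peval (h i) x) ^ (2 * k)" using i \<mu> by (intro one_le_power) simp
      then have "?t i \<le> 1 * peval (h i) x" using i \<mu> by (intro mult_right_mono_neg) auto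
      then have ti: "?t i \<le> - \<mu>" using i by simp
      have "peval s x = ?t i + (\<Sum>i\<in>{1..m} - {i}. ?t i)" unfolding ps using i by (subst sum.remove[of _ i]) auto
      also have "\<dots> \<le> - \<mu> + (\<Sum>i\<in>{1..m} - {i}. 1 / real (2 * k))" by (intro add_mono sum_mono ti le) auto
      also have "\<dots> \<le> - \<mu> + (\<Sum>i\<in>{1..m}. 1 / real (2 * k))" by (intro add_left_mono sum_mono2) auto
      also have "\<dots> \<le> - \<mu> + B" using k by simp
      also have "\<dots> \<le> - (\<mu> / 2)" by (simp add: B_def)
      finally have "c * peval s x \<le> c * (- (\<mu> / 2))" using c by (intro mult_left_mono) auto
      also have "\<dots> = - (\<bar>bd q\<bar> + 1)" using \<mu> by (simp add: c_def field_simps)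
      finally show ?thesis using bd[OF x, of q] by simp
    qed
  qed
  then have "q - pconst c * s \<in> qmod m g" using ball_cone_subset_qmod[OF arch] by blast
  moreover have "pconst c * s \<in> qmod m g"
    unfolding s_def sum_distrib_left
  proof (rule qmod_sum)
    fix i assume i: "i \<in> {1..m}"
    have "(pconst (c / \<gamma>) * ((1 - h i) ^ k) ^ 2) * g i \<in> qmod m g"
      using c \<gamma> by (intro qmod_mult qmod_generator[OF i] sos_mult sos_pconst sos_square) auto
    moreover have "pconst c * ((1 - h i) ^ (2 * k) * h i) = (pconst (c / \<gamma>) * ((1 - h i) ^ k) ^ 2) * g i"
    proof -
      have "pconst (c / \<gamma>) = (pconst c * pconst (1 / \<gamma>) :: 'n rpoly)" by (simp flip: pconst_mult)
      moreover have "(1 - h i) ^ (2 * k) = ((1 - h i) ^ k) ^ 2" by (simp add: mult.commute flip: power_mult)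
      ultimately have "(pconst (c / \<gamma>) * ((1 - h i) ^ k) ^ 2) * g i = pconst c * ((1 - h i) ^ (2 * k) * (pconst (1 / \<gamma>) * g i))"
        by (simp only: mult_ac)
      then show ?thesis by (simp only: h_def)
    qed
    ultimately show "pconst c * ((1 - h i) ^ (2 * k) * h i) \<in> qmod m g" by simp
  qed
  ultimately show ?thesis using qmod_add[of "q - pconst c * s" m g "pconst c * s"] by simp
qed

section \<open>A weighted coefficient norm and the growth of iterated Lie derivatives\<close>

definition mon_degree :: "('n::finite \<Rightarrow>\<^sub>0 nat) \<Rightarrow> nat" where
  "mon_degree e = (\<Sum>i\<in>UNIV. Poly_Mapping.lookup e i)"

lemma mon_degree_add: "mon_degree (a + b) = mon_degree a + mon_degree b"
  by (simp add: mon_degree_def lookup_add sum.distrib)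

lemma mon_degree_diff_single:
  "mon_degree (e - Poly_Mapping.single i 1) = mon_degree e - (if Poly_Mapping.lookup e i = 0 then 0 else 1)"
proof -
  have "mon_degree (e - Poly_Mapping.single i 1) =
     (Poly_Mapping.lookup e i - 1) + (\<Sum>j\<in>UNIV - {i}. Poly_Mapping.lookup e j)"
    unfolding mon_degree_def
    by (subst sum.remove[of _ i]) (auto simp: lookup_minus lookup_single when_def intro!: sum.cong)
  moreover have "mon_degree e = Poly_Mapping.lookup e i + (\<Sum>j\<in>UNIV - {i}. Poly_Mapping.lookup e j)"
    unfolding mon_degree_def by (subst sum.remove[of _ i]) auto
  ultimately show ?thesis by auto
qed

lemma mon_degree_le_pdeg: "e \<in> Poly_Mapping.keys p \<Longrightarrow> mon_degree e \<le> pdeg p"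
  unfolding pdeg_def mon_degree_def by (intro Max_ge) auto

lemma pdeg_leI: "(\<And>e. e \<in> Poly_Mapping.keys p \<Longrightarrow> mon_degree e \<le> d) \<Longrightarrow> pdeg p \<le> d"
  unfolding pdeg_def mon_degree_def by (subst Max_le_iff) auto

lemma keys_sumD: "e \<in> Poly_Mapping.keys (\<Sum>j\<in>S. p j) \<Longrightarrow> \<exists>j\<in>S. e \<in> Poly_Mapping.keys (p j)"
  by (induct S rule: infinite_finite_induct) (auto dest: Poly_Mapping.keys_add[THEN subsetD])

lemma pdeg_dot_grad: "pdeg (dot_grad f V) \<le> pdeg V + field_deg f"
proof (rule pdeg_leI)
  fix e assume "e \<in> Poly_Mapping.keys (dot_grad f V)"
  then obtain i where "e \<in> Poly_Mapping.keys (f i * pdiff i V)"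
    unfolding dot_grad_def by (blast dest: keys_sumD)
  then obtain b c where e: "e = b + c" "b \<in> Poly_Mapping.keys (f i)" "c \<in> Poly_Mapping.keys (pdiff i V)"
    using Poly_Mapping.keys_mult by blast
  then obtain c' where c: "c' \<in> Poly_Mapping.keys V" "c = c' - Poly_Mapping.single i 1"
    unfolding pdiff_def by (auto dest!: keys_sumD split: if_splits)
  have "mon_degree c \<le> pdeg V"
    using mon_degree_le_pdeg[OF c(1)] unfolding c(2) mon_degree_diff_single by linarith
  moreover have "mon_degree b \<le> field_deg f"
    using mon_degree_le_pdeg[OF e(2)] unfolding field_deg_def by (meson Max_ge finite finite_imageI le_trans rangeI)
  ultimately show "mon_degree e \<le> pdeg V + field_deg f" by (simp add: e(1) mon_degree_add)
qed

text \<open>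
The coefficient norm with weight \<open>R\<close> per degree: submultiplicative, and an upper bound for the values on the
cube of half-width \<open>R\<close>.
\<close>

definition pnorm :: "real \<Rightarrow> 'n::finite rpoly \<Rightarrow> real" where
  "pnorm R p = (\<Sum>e\<in>Poly_Mapping.keys p. \<bar>Poly_Mapping.lookup p e\<bar> * R ^ mon_degree e)"

context
  fixes R :: real
  assumes R: "0 < R"
begin

lemma pnorm_nonneg: "0 \<le> pnorm R p"
  unfolding pnorm_def using R by (intro sum_nonneg) auto

lemma pnorm_superset:
  assumes "finite S" "Poly_Mapping.keys p \<subseteq> S"
  shows "pnorm R p = (\<Sum>e\<in>S. \<bar>Poly_Mapping.lookup p e\<bar> * R ^ mon_degree e)"
  unfolding pnorm_def using assms
  by (intro sum.mono_neutral_left) (auto simp: in_keys_iff)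

lemma pnorm_add: "pnorm R (p + q) \<le> pnorm R p + pnorm R q"
proof -
  let ?S = "Poly_Mapping.keys p \<union> Poly_Mapping.keys q"
  have "Poly_Mapping.keys (p + q) \<subseteq> ?S" by (rule Poly_Mapping.keys_add)
  then have "pnorm R (p + q) = (\<Sum>e\<in>?S. \<bar>Poly_Mapping.lookup p e + Poly_Mapping.lookup q e\<bar> * R ^ mon_degree e)"
    by (simp add: pnorm_superset[of ?S] lookup_add)
  also have "\<dots> \<le> (\<Sum>e\<in>?S. \<bar>Poly_Mapping.lookup p e\<bar> * R ^ mon_degree e + \<bar>Poly_Mapping.lookup q e\<bar> * R ^ mon_degree e)"
    using R by (intro sum_mono) (simp flip: distrib_right)
  also have "\<dots> = pnorm R p + pnorm R q"
    by (simp add: pnorm_superset[of ?S] sum.distrib)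
  finally show ?thesis .
qed

lemma pnorm_sum: "pnorm R (\<Sum>j\<in>S. p j) \<le> (\<Sum>j\<in>S. pnorm R (p j))"
  by (induct S rule: infinite_finite_induct)
     (auto simp: pnorm_def[of _ 0] intro: order_trans[OF pnorm_add])

lemma pnorm_single: "pnorm R (Poly_Mapping.single e c) = \<bar>c\<bar> * R ^ mon_degree e"
  by (cases "c = 0") (auto simp: pnorm_def)

lemma pnorm_mult: "pnorm R (p * q) \<le> pnorm R p * pnorm R q"
proof -
  have "pnorm R (p * q) \<le> (\<Sum>a\<in>Poly_Mapping.keys p. \<Sum>b\<in>Poly_Mapping.keys q.
     pnorm R (Poly_Mapping.single (a + b) (Poly_Mapping.lookup p a * Poly_Mapping.lookup q b)))"
    by (subst mult_sum_of_monomials) (intro order_trans[OF pnorm_sum] sum_mono order_refl)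
  also have "\<dots> = pnorm R p * pnorm R q"
    by (simp add: pnorm_single) (simp add: pnorm_def sum_product mon_degree_add power_add abs_mult mult_ac)
  finally show ?thesis .
qed

lemma abs_peval_le_pnorm:
  assumes "\<And>i. \<bar>x $ i\<bar> \<le> R"
  shows "\<bar>peval p x\<bar> \<le> pnorm R p"
proof -
  have "\<bar>\<Prod>i\<in>UNIV. (x $ i) ^ Poly_Mapping.lookup e i\<bar> \<le> R ^ mon_degree e" for e :: "'a \<Rightarrow>\<^sub>0 nat"
  proof -
    have "\<bar>\<Prod>i\<in>UNIV. (x $ i) ^ Poly_Mapping.lookup e i\<bar> \<le> (\<Prod>i\<in>UNIV. R ^ Poly_Mapping.lookup e i)"
      unfolding abs_prod by (intro prod_mono) (auto simp: power_abs intro: power_mono assms)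
    then show ?thesis by (simp add: mon_degree_def power_sum)
  qed
  then show ?thesis
    unfolding peval_def pnorm_def
    by (intro order_trans[OF sum_abs] sum_mono) (auto simp: abs_mult intro: mult_left_mono)
qed

lemma pnorm_pdiff:
  "pnorm R (pdiff i V) \<le> (\<Sum>e\<in>Poly_Mapping.keys V.
      \<bar>Poly_Mapping.lookup V e\<bar> * real (Poly_Mapping.lookup e i) * R ^ mon_degree e / R)"
proof -
  have "pnorm R (Poly_Mapping.single (e - Poly_Mapping.single i 1)
          (Poly_Mapping.lookup V e * real (Poly_Mapping.lookup e i)))
      = \<bar>Poly_Mapping.lookup V e\<bar> * real (Poly_Mapping.lookup e i) * R ^ mon_degree e / R" for e
  proof (cases "Poly_Mapping.lookup e i = 0")
    case True
    then show ?thesis by (simp add: pnorm_def)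
  next
    case False
    then have "mon_degree e \<noteq> 0" by (auto simp: mon_degree_def)
    then have "R ^ mon_degree e = R * R ^ (mon_degree e - 1)" by (simp add: power_eq_if)
    then have eq: "R ^ (mon_degree e - Suc 0) = R ^ mon_degree e / R" using R by simp
    show ?thesis
      using False by (simp add: pnorm_single mon_degree_diff_single[unfolded One_nat_def] abs_mult eq)
  qed
  then show ?thesis
    unfolding pdiff_def by (intro order_trans[OF pnorm_sum]) simp
qed

text \<open>
Differentiation costs a factor \<open>deg / R\<close>: summing over the variables turns the exponents \<open>e i\<close> into the
degree of the monomial.
\<close>

lemma pnorm_dot_grad:
  assumes F: "\<And>i. pnorm R (f i) \<le> F" "0 \<le> F"
  shows "pnorm R (dot_grad f V) \<le> real (pdeg V) * (F / R) * pnorm R V"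
proof -
  have "pnorm R (dot_grad f V) \<le> (\<Sum>i\<in>UNIV. F * pnorm R (pdiff i V))"
    unfolding dot_grad_def
    by (intro order_trans[OF pnorm_sum] sum_mono order_trans[OF pnorm_mult] mult_right_mono F pnorm_nonneg)
  also have "\<dots> \<le> (\<Sum>i\<in>UNIV. F * (\<Sum>e\<in>Poly_Mapping.keys V.
      \<bar>Poly_Mapping.lookup V e\<bar> * real (Poly_Mapping.lookup e i) * R ^ mon_degree e / R))"
    by (intro sum_mono mult_left_mono F pnorm_pdiff)
  also have "\<dots> = F * (\<Sum>e\<in>Poly_Mapping.keys V. \<Sum>i\<in>UNIV.
      \<bar>Poly_Mapping.lookup V e\<bar> * real (Poly_Mapping.lookup e i) * R ^ mon_degree e / R)"
    by (subst sum.swap) (simp add: sum_distrib_left)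
  also have "\<dots> = F * (\<Sum>e\<in>Poly_Mapping.keys V. real (mon_degree e) * (\<bar>Poly_Mapping.lookup V e\<bar> * R ^ mon_degree e / R))"
    by (simp add: mon_degree_def[abs_def] sum_distrib_right sum_distrib_left sum_divide_distrib mult_ac)
  also have "\<dots> \<le> F * (\<Sum>e\<in>Poly_Mapping.keys V. real (pdeg V) * (\<bar>Poly_Mapping.lookup V e\<bar> * R ^ mon_degree e / R))"
    using R F(2) by (intro sum_mono mult_left_mono mult_right_mono) (auto intro: mon_degree_le_pdeg)
  also have "\<dots> = real (pdeg V) * (F / R) * pnorm R V"
    by (simp add: pnorm_def sum_distrib_left sum_divide_distrib algebra_simps)
  finally show ?thesis .
qed

lemma pdeg_lie: "pdeg ((dot_grad f ^^ k) W) \<le> pdeg W + k * field_deg f"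
proof (induct k)
  case (Suc k)
  then show ?case using pdeg_dot_grad[of f "(dot_grad f ^^ k) W"] by simp
qed simp

text \<open>
The \<open>k\<close>-th iterate has degree at most \<open>pdeg W + k m \<le> m (pdeg W + k + 1)\<close>, so the factors of
\<open>pnorm_dot_grad\<close> multiply up to a quotient of factorials.
\<close>

lemma pnorm_lie:
  assumes F: "\<And>i. pnorm R (f i) \<le> F" "0 \<le> F" and m: "field_deg f \<le> m" "1 \<le> m"
  shows "pnorm R ((dot_grad f ^^ k) W) \<le> pnorm R W * (real m * F / R) ^ k * (fact (pdeg W + k) / fact (pdeg W))"
proof (induct k)
  case (Suc k)
  let ?p = "(dot_grad f ^^ k) W" and ?d = "pdeg W"
  have "k * field_deg f \<le> m * k" using m by simp
  moreover have "?d \<le> m * ?d" using m by simp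
  ultimately have "pdeg ?p \<le> m * (?d + Suc k)"
    using pdeg_lie[where f = f and k = k and W = W] by (simp only: distrib_left mult_Suc_right)
  then have deg: "real (pdeg ?p) \<le> real m * real (?d + Suc k)"
    by (metis of_nat_le_iff of_nat_mult)
  have "pnorm R ((dot_grad f ^^ Suc k) W) \<le> real (pdeg ?p) * (F / R) * pnorm R ?p"
    using pnorm_dot_grad[OF F] by simp
  also have "\<dots> \<le> (real m * real (?d + Suc k)) * (F / R) *
     (pnorm R W * (real m * F / R) ^ k * (fact (?d + k) / fact ?d))"
    using R F(2) deg Suc by (intro mult_mono) (auto intro!: pnorm_nonneg)
  also have "\<dots> = pnorm R W * (real m * F / R) ^ Suc k * (fact (?d + Suc k) / fact ?d)"
    by (simp add: field_simps)
  finally show ?case .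
qed simp

text \<open>
The factorial growth of the iterates is compensated by \<open>k!\<close> up to a binomial coefficient, bounded by
\<open>2^(pdeg W + k)\<close>. The admissible times depend on \<open>f\<close> and \<open>R\<close> only, not on \<open>W\<close>.
\<close>

lemma lie_series_term_bound:
  assumes F: "\<And>i. pnorm R (f i) \<le> F" "0 \<le> F" and m: "field_deg f \<le> m" "1 \<le> m"
    and t: "0 \<le> t" "4 * real m * F * t \<le> R"
  shows "pnorm R ((dot_grad f ^^ k) W) * (t ^ k / fact k) \<le> pnorm R W * 2 ^ pdeg W * (1/2) ^ k"
proof -
  let ?d = "pdeg W"
  have b: "fact (?d + k) / (fact ?d * fact k) = (real ((?d + k) choose k))"
    by (simp add: binomial_fact mult.commute)
  have "real ((?d + k) choose k) \<le> 2 ^ (?d + k)"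
    by (metis binomial_le_pow2 of_nat_le_iff of_nat_numeral of_nat_power)
  have "pnorm R ((dot_grad f ^^ k) W) * (t ^ k / fact k) \<le>
     pnorm R W * (real m * F / R) ^ k * (fact (?d + k) / fact ?d) * (t ^ k / fact k)"
    using pnorm_lie[OF F m] t by (intro mult_right_mono) auto
  also have "\<dots> = pnorm R W * ((real m * F / R) * t) ^ k * (fact (?d + k) / (fact ?d * fact k))"
    by (simp only: power_mult_distrib) (simp add: field_simps)
  also have "\<dots> \<le> pnorm R W * (1/4) ^ k * 2 ^ (?d + k)"
    unfolding b
  proof (intro mult_mono power_mono)
    show "real m * F / R * t \<le> 1 / 4" using R t by (simp add: field_simps)
  qed (use R F(2) t pnorm_nonneg[of W] \<open>real ((?d + k) choose k) \<le> 2 ^ (?d + k)\<close> in auto)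
  also have "\<dots> = pnorm R W * 2 ^ ?d * (1/2) ^ k"
  proof -
    have "(1/4::real) ^ k * 2 ^ k = (1/2) ^ k" by (simp flip: power_mult_distrib)
    then show ?thesis by (simp add: power_add mult_ac)
  qed
  finally show ?thesis .
qed

end

section \<open>Lie series of a polynomial flow\<close>

text \<open>
One-sided derivatives at both ends suffice, which fits solutions that are defined for nonnegative times.
\<close>

lemma taylor_remainder_bound:
  fixes w :: "nat \<Rightarrow> real \<Rightarrow> real"
  assumes t: "0 \<le> t"
    and d: "\<And>k s. k < N \<Longrightarrow> 0 \<le> s \<Longrightarrow> s \<le> t \<Longrightarrow> (w k has_real_derivative w (Suc k) s) (at s within {0..t})"
    and B: "\<And>s. 0 \<le> s \<Longrightarrow> s \<le> t \<Longrightarrow> \<bar>w N s\<bar> \<le> B"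
  shows "\<bar>w 0 t - (\<Sum>k<N. t ^ k / fact k * w k 0)\<bar> \<le> B * (t ^ N / fact N)"
proof (cases "N = 0")
  case True
  then show ?thesis using B[of t] t by simp
next
  case False
  then have N: "0 < N" by simp
  let ?i = "\<lambda>x. ((t - x) ^ (N - 1) / fact (N - 1)) *\<^sub>R w N x"
  let ?g = "\<lambda>x. B * ((t - x) ^ (N - 1) / fact (N - 1))"
  have I: "(?i has_integral w 0 t - (\<Sum>k<N. ((t - 0) ^ k / fact k) *\<^sub>R w k 0)) {0..t}"
    by (rule Taylor_has_integral[OF N refl _ t])
       (use d in \<open>simp add: has_real_derivative_iff_has_vector_derivative\<close>)
  have "((\<lambda>y. - ((t - y) ^ N / fact N)) has_real_derivative ((t - x) ^ (N - 1) / fact (N - 1))) (at x within {0..t})" for x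
  proof -
    have "fact N = real N * fact (N - 1)" using N by (simp add: fact_reduce)
    then show ?thesis
      using N by (auto intro!: derivative_eq_intros simp: field_simps)
  qed
  then have "((\<lambda>x. (t - x) ^ (N - 1) / fact (N - 1)) has_integral (- ((t - t) ^ N / fact N) - (- ((t - 0) ^ N / fact N)))) {0..t}"
    by (intro fundamental_theorem_of_calculus t) (auto simp: has_real_derivative_iff_has_vector_derivative)
  then have "((\<lambda>x. (t - x) ^ (N - 1) / fact (N - 1)) has_integral t ^ N / fact N) {0..t}"
    using N by (simp add: zero_power)
  then have J: "(?g has_integral B * (t ^ N / fact N)) {0..t}"
    by (rule has_integral_mult_right)
  have "norm (integral {0..t} ?i) \<le> integral {0..t} ?g"
    using I J B
    by (intro integral_norm_bound_integral)
       (auto simp: integrable_on_def abs_mult mult.commute[of "B"] intro!: mult_left_mono divide_right_mono)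
  then show ?thesis
    unfolding integral_unique[OF I] integral_unique[OF J] by simp
qed

lemma solution_component:
  assumes "forward_solution (field_eval f) x z" "0 \<le> t"
  shows "((\<lambda>t. z t $ i) has_real_derivative peval (f i) (z t)) (at t within {0..})"
  using bounded_linear.has_vector_derivative[OF bounded_linear_vec_nth, of z "field_eval f (z t)" "at t within {0..}" i] assms
  by (simp add: forward_solution_def has_real_derivative_iff_has_vector_derivative field_eval_def)

lemma solution_continuous:
  assumes "forward_solution F x z"
  shows "continuous_on {0..} z"
  unfolding continuous_on_eq_continuous_within
  using assms by (auto simp: forward_solution_def intro: has_vector_derivative_continuous)

text \<open>
At the first time when some coordinate has moved by 1, the mean value theorem would give a velocity
larger than the bound \<open>F\<close> valid on the box up to that time.
\<close>

lemma solution_stays_in_box: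
  fixes z :: "real \<Rightarrow> real ^ 'n::finite"
  assumes sol: "forward_solution (field_eval f) x z"
    and x: "\<And>i. \<bar>x $ i\<bar> \<le> R - 1" and R: "0 < R"
    and F: "\<And>i. pnorm R (f i) \<le> F" and tau: "\<tau> * F < 1" and t: "0 \<le> t" "t \<le> \<tau>"
  shows "\<bar>z t $ i\<bar> \<le> R"
proof -
  define S where "S = {s \<in> {0..\<tau>}. \<exists>i. 1 \<le> \<bar>z s $ i - x $ i\<bar>}"
  have cont: "continuous_on {0..} (\<lambda>s. z s $ i)" for i
    using solution_continuous[OF sol] by (intro continuous_intros)
  have z0: "z 0 = x" using sol by (simp add: forward_solution_def)
  have "S = {}"
  proof (rule ccontr)
    assume ne: "S \<noteq> {}"
    have "S = (\<Union>i. {s \<in> {0..\<tau>}. 1 \<le> \<bar>z s $ i - x $ i\<bar>})" by (auto simp: S_def)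
    moreover have "closed {s \<in> {0..\<tau>}. 1 \<le> \<bar>z s $ i - x $ i\<bar>}" for i
    proof -
      have "continuous_on {0..\<tau>} (\<lambda>s. \<bar>z s $ i - x $ i\<bar>)"
        by (intro continuous_intros continuous_on_subset[OF cont]) auto
      then have "closed ({0..\<tau>} \<inter> (\<lambda>s. \<bar>z s $ i - x $ i\<bar>) -` {1..})"
        by (rule continuous_closed_preimage) auto
      moreover have "{0..\<tau>} \<inter> (\<lambda>s. \<bar>z s $ i - x $ i\<bar>) -` {1..} = {s \<in> {0..\<tau>}. 1 \<le> \<bar>z s $ i - x $ i\<bar>}"
        by auto
      ultimately show ?thesis by simp
    qed
    ultimately have "closed S" by auto
    have bdd: "bdd_below S" by (auto simp: S_def intro: bdd_belowI[of _ 0])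
    define s where "s = Inf S"
    have "s \<in> S" unfolding s_def using ne bdd \<open>closed S\<close> by (rule closed_contains_Inf)
    then obtain i where s: "0 \<le> s" "s \<le> \<tau>" "1 \<le> \<bar>z s $ i - x $ i\<bar>" by (auto simp: S_def)
    then have "s \<noteq> 0" using z0 by auto
    then have s0: "0 < s" using s by simp
    have "\<exists>\<xi>\<in>{0<..<s}. z s $ i - z 0 $ i = (\<lambda>v. v * peval (f i) (z \<xi>)) (s - 0)"
    proof (rule mvt_simple[OF s0, of "\<lambda>t. z t $ i" "\<lambda>\<xi> v. v * peval (f i) (z \<xi>)"])
      fix \<xi> assume \<xi>: "0 \<le> \<xi>" "\<xi> \<le> s"
      have "((\<lambda>t. z t $ i) has_real_derivative peval (f i) (z \<xi>)) (at \<xi> within {0..s})"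
        by (rule has_field_derivative_subset[OF solution_component[OF sol \<xi>(1)]]) auto
      then show "((\<lambda>t. z t $ i) has_derivative (\<lambda>v. v * peval (f i) (z \<xi>))) (at \<xi> within {0..s})"
        unfolding has_field_derivative_def by (rule has_derivative_eq_rhs) (simp add: fun_eq_iff)
    qed
    then obtain \<xi> where \<xi>: "0 < \<xi>" "\<xi> < s" and eq: "z s $ i - x $ i = s * peval (f i) (z \<xi>)"
      using z0 by auto
    have "\<xi> \<notin> S" using \<xi> cInf_lower[OF _ bdd, of \<xi>] unfolding s_def by auto
    then have "\<bar>z \<xi> $ j - x $ j\<bar> < 1" for j
      using \<xi> s by (auto simp: S_def not_le)
    then have "\<bar>z \<xi> $ j\<bar> \<le> R" for j
      using x[of j] by (smt (verit))
    then have "\<bar>peval (f i) (z \<xi>)\<bar> \<le> F"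
      using abs_peval_le_pnorm[OF R] F order_trans by blast
    then have "\<bar>z s $ i - x $ i\<bar> \<le> \<tau> * F"
      unfolding eq abs_mult using s by (intro mult_mono) auto
    then show False using s tau by simp
  qed
  then have "t \<notin> S" by simp
  then have "\<bar>z t $ i - x $ i\<bar> < 1" using t by (auto simp: S_def not_le)
  then show ?thesis using x[of i] by (smt (verit))
qed

text \<open>
The convergence of Lie series on \<open>\<Omega>\<close> up to time \<open>\<tau>\<close> rests on two facts: solutions
that start in \<open>\<Omega>\<close> stay in a box for time \<open>\<tau>\<close>, and on this box the terms of every Lie series decay
geometrically.
\<close>

locale lie_flow =
  fixes f :: "'n::finite \<Rightarrow> 'n rpoly" and \<Omega> :: "(real ^ 'n) set" and R \<tau> :: real
  assumes R: "0 < R" and \<tau>: "0 < \<tau>"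
    and stays: "\<And>x z t i. x \<in> \<Omega> \<Longrightarrow> forward_solution (field_eval f) x z \<Longrightarrow> 0 \<le> t \<Longrightarrow> t \<le> \<tau> \<Longrightarrow> \<bar>z t $ i\<bar> \<le> R"
    and term_bound: "\<And>W k. pnorm R ((dot_grad f ^^ k) W) * (\<tau> ^ k / fact k) \<le> pnorm R W * 2 ^ pdeg W * (1/2) ^ k"

lemma lie_flow_exists:
  fixes f :: "'n::finite \<Rightarrow> 'n rpoly"
  assumes "bounded \<Omega>"
  obtains R \<tau> where "lie_flow f \<Omega> R \<tau>"
proof -
  obtain B where B: "0 < B" "\<And>x. x \<in> \<Omega> \<Longrightarrow> norm x \<le> B" using assms bounded_pos by blast
  define R where "R = B + 1"
  have R: "0 < R" using B by (simp add: R_def)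
  define F where "F = (\<Sum>i\<in>UNIV. pnorm R (f i)) + 1"
  have F: "pnorm R (f i) \<le> F" for i
  proof -
    have "pnorm R (f i) \<le> (\<Sum>i\<in>UNIV. pnorm R (f i))"
      by (rule member_le_sum) (auto simp: pnorm_nonneg[OF R])
    then show ?thesis by (simp add: F_def)
  qed
  have F0: "0 < F" unfolding F_def by (simp add: add_nonneg_pos sum_nonneg pnorm_nonneg[OF R])
  define m where "m = field_deg f + 1"
  \<comment> \<open>the first bound keeps solutions in the box, the second one is the radius in \<open>lie_series_term_bound\<close>\<close>
  define \<tau> where "\<tau> = min (1 / (2 * F)) (R / (4 * real m * F))"
  have m: "0 < real m" by (simp add: m_def)
  have t0: "0 < \<tau>" using F0 R m by (simp add: \<tau>_def)
  have t1: "\<tau> * F < 1"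
  proof -
    have "\<tau> * F \<le> 1 / (2 * F) * F" using F0 by (intro mult_right_mono) (auto simp: \<tau>_def)
    then show ?thesis using F0 by simp
  qed
  have "(4 * real m * F) * \<tau> \<le> (4 * real m * F) * (R / (4 * real m * F))"
    using F0 m by (intro mult_left_mono) (auto simp: \<tau>_def)
  then have t2: "4 * real m * F * \<tau> \<le> R" using F0 m by simp
  have box: "\<bar>x $ i\<bar> \<le> R - 1" if "x \<in> \<Omega>" for x i
    using B(2)[OF that] component_le_norm_cart[of x i] by (simp add: R_def)
  have "lie_flow f \<Omega> R \<tau>"
  proof
    show "\<bar>z t $ i\<bar> \<le> R" if "x \<in> \<Omega>" "forward_solution (field_eval f) x z" "0 \<le> t" "t \<le> \<tau>" for x z t i
      using solution_stays_in_box[OF that(2) box[OF that(1)] R F t1 that(3,4)] .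
    show "pnorm R ((dot_grad f ^^ k) W) * (\<tau> ^ k / fact k) \<le> pnorm R W * 2 ^ pdeg W * (1/2) ^ k" for W k
      by (rule lie_series_term_bound[OF R, of _ F m]) (use F F0 t0 t2 in \<open>auto simp: m_def\<close>)
  qed (use R t0 in auto)
  then show ?thesis by (rule that)
qed

lemma continuous_on_approximable:
  fixes h :: "real ^ 'n::finite \<Rightarrow> real"
  assumes "\<And>e. 0 < e \<Longrightarrow> \<exists>p. \<forall>x\<in>S. \<bar>h x - peval p x\<bar> < e"
  shows "continuous_on S h"
proof -
  have "\<exists>p. \<forall>n::nat. \<forall>x\<in>S. \<bar>h x - peval (p n) x\<bar> < 1 / real (Suc n)"
    by (intro choice allI assms) simp
  then obtain p where p: "\<And>n x. x \<in> S \<Longrightarrow> \<bar>h x - peval (p n) x\<bar> < 1 / real (Suc n)" by blast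
  have "uniform_limit S (\<lambda>n. peval (p n)) h sequentially"
  proof (rule uniform_limitI)
    fix e :: real assume "0 < e"
    then obtain n0 where "1 / real (Suc n0) < e" using nat_approx_posE by metis
    moreover have "\<bar>h x - peval (p n) x\<bar> < 1 / real (Suc n0)" if "n0 \<le> n" "x \<in> S" for n x
    proof -
      have "1 / real (Suc n) \<le> 1 / real (Suc n0)" using that by (intro frac_le) auto
      then show ?thesis using p[OF that(2), of n] by linarith
    qed
    ultimately have "\<forall>n\<ge>n0. \<forall>x\<in>S. dist (peval (p n) x) (h x) < e"
      by (metis abs_minus_commute dist_real_def less_trans)
    then show "\<forall>\<^sub>F n in sequentially. \<forall>x\<in>S. dist (peval (p n) x) (h x) < e"
      using eventually_sequentially by blast
  qed
  then show ?thesis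
    by (rule uniform_limit_theorem[rotated]) (auto intro!: always_eventually continuous_intros)
qed

context lie_flow
begin

definition decay :: "'n rpoly \<Rightarrow> nat \<Rightarrow> real" where
  "decay W N = pnorm R W * 2 ^ pdeg W * (1/2) ^ N"

lemma decay_tendsto: "(\<lambda>N. c * decay W (Suc N)) \<longlonglongrightarrow> 0"
proof -
  have "(\<lambda>N. (c * (pnorm R W * 2 ^ pdeg W)) * (1/2::real) ^ N) \<longlonglongrightarrow> 0"
    by (intro tendsto_mult_right_zero LIMSEQ_power_zero) simp
  from LIMSEQ_Suc[OF this] show ?thesis by (simp add: decay_def mult_ac)
qed

lemma decay_small:
  assumes "0 < e" shows "\<exists>N. c * decay W (Suc N) < e"
  using order_tendstoD(2)[OF decay_tendsto assms] eventually_happens by fastforce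

lemma abs_peval_solution:
  assumes "x \<in> \<Omega>" "forward_solution (field_eval f) x z" "0 \<le> t" "t \<le> \<tau>"
  shows "\<bar>peval W (z t)\<bar> \<le> pnorm R W"
  using stays[OF assms] by (intro abs_peval_le_pnorm R)

lemma peval_lie_derivative:
  assumes "forward_solution (field_eval f) x z" "0 \<le> s"
  shows "((\<lambda>t. peval ((dot_grad f ^^ k) W) (z t)) has_real_derivative peval ((dot_grad f ^^ Suc k) W) (z s)) (at s within {0..})"
  using peval_along_solution[of z f s "{0..}" "(dot_grad f ^^ k) W"] assms by (simp add: forward_solution_def)

text \<open>
The \<open>k\<close>-th time derivative of \<open>W\<close> along a solution is the \<open>k\<close>-th Lie derivative, so this is Taylor's
theorem in time.
\<close>

lemma lie_series:
  assumes x: "x \<in> \<Omega>" and z: "forward_solution (field_eval f) x z" and t: "0 \<le> t" "t \<le> \<tau>"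
  shows "\<bar>peval W (z t) - (\<Sum>k<N. t ^ k / fact k * peval ((dot_grad f ^^ k) W) x)\<bar> \<le> decay W N"
proof -
  let ?B = "pnorm R ((dot_grad f ^^ N) W)"
  have "\<bar>peval W (z t) - (\<Sum>k<N. t ^ k / fact k * peval ((dot_grad f ^^ k) W) (z 0))\<bar> \<le> ?B * (t ^ N / fact N)"
  proof (rule taylor_remainder_bound[of t N "\<lambda>k t. peval ((dot_grad f ^^ k) W) (z t)" ?B, simplified funpow_0 id_apply])
    show "((\<lambda>t. peval ((dot_grad f ^^ k) W) (z t)) has_real_derivative peval ((dot_grad f ^^ Suc k) W) (z s)) (at s within {0..t})"
      if "0 \<le> s" for k s
      by (rule has_field_derivative_subset[OF peval_lie_derivative[OF z that]]) auto
  qed (use t abs_peval_solution[OF x z] in auto)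
  also have "\<dots> \<le> ?B * (\<tau> ^ N / fact N)"
    using t by (intro mult_left_mono divide_right_mono power_mono pnorm_nonneg R) auto
  also have "\<dots> \<le> decay W N" using term_bound by (simp add: decay_def)
  finally show ?thesis using z by (simp add: forward_solution_def)
qed

text \<open>
Taylor's theorem once more, for the primitive: its higher derivatives are the Lie derivatives with index
shifted by one.
\<close>

lemma lie_series_integral:
  assumes x: "x \<in> \<Omega>" and z: "forward_solution (field_eval f) x z"
  shows "\<bar>integral {0..\<tau>} (\<lambda>s. peval W (z s)) - (\<Sum>k<N. \<tau> ^ Suc k / fact (Suc k) * peval ((dot_grad f ^^ k) W) x)\<bar>
      \<le> \<tau> * decay W N"
proof -
  let ?B = "pnorm R ((dot_grad f ^^ N) W)"
  define w where "w k t = (case k of 0 \<Rightarrow> integral {0..t} (\<lambda>s. peval W (z s))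
     | Suc k \<Rightarrow> peval ((dot_grad f ^^ k) W) (z t))" for k t
  have deriv: "(w k has_real_derivative w (Suc k) s) (at s within {0..\<tau>})" if "0 \<le> s" "s \<le> \<tau>" for k s
  proof (cases k)
    case 0
    have "continuous_on {0..\<tau>} (\<lambda>s. peval W (z s))"
      by (intro continuous_intros continuous_on_subset[OF solution_continuous[OF z]]) auto
    then show ?thesis
      using integral_has_real_derivative[of 0 \<tau> "\<lambda>s. peval W (z s)" s] that by (simp add: 0 w_def[abs_def])
  next
    case (Suc k')
    then show ?thesis
      using has_field_derivative_subset[OF peval_lie_derivative[OF z, of s], of "{0..\<tau>}" k' W] that
      by (simp add: w_def[abs_def])
  qed
  have "\<bar>w 0 \<tau> - (\<Sum>k<Suc N. \<tau> ^ k / fact k * w k 0)\<bar> \<le> ?B * (\<tau> ^ Suc N / fact (Suc N))"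
    by (rule taylor_remainder_bound) (use \<tau> in simp, rule deriv, assumption+, use abs_peval_solution[OF x z] in \<open>simp add: w_def\<close>)
  moreover have "(\<Sum>k<Suc N. \<tau> ^ k / fact k * w k 0) = (\<Sum>k<N. \<tau> ^ Suc k / fact (Suc k) * peval ((dot_grad f ^^ k) W) x)"
    using z by (subst sum.lessThan_Suc_shift) (simp add: w_def forward_solution_def)
  moreover have "?B * (\<tau> ^ Suc N / fact (Suc N)) \<le> \<tau> * (?B * (\<tau> ^ N / fact N))"
  proof -
    have "\<tau> ^ Suc N / fact (Suc N) \<le> \<tau> ^ Suc N / fact N"
      using \<tau> by (intro divide_left_mono fact_mono) auto
    then have "?B * (\<tau> ^ Suc N / fact (Suc N)) \<le> ?B * (\<tau> ^ Suc N / fact N)"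
      by (intro mult_left_mono pnorm_nonneg R)
    then show ?thesis by (simp add: mult_ac)
  qed
  moreover have "\<tau> * (?B * (\<tau> ^ N / fact N)) \<le> \<tau> * decay W N"
    using term_bound \<tau> by (intro mult_left_mono) (auto simp: decay_def)
  ultimately show ?thesis by (simp add: w_def)
qed

text \<open>
The Lie series of the coordinates depend on the initial point only.
\<close>

lemma solution_unique:
  assumes x: "x \<in> \<Omega>" and z: "forward_solution (field_eval f) x z" "forward_solution (field_eval f) x z'"
    and t: "0 \<le> t" "t \<le> \<tau>"
  shows "z t = z' t"
proof -
  have "\<bar>z t $ i - z' t $ i\<bar> \<le> 0" for i
  proof (rule field_le_epsilon)
    fix e :: real assume "0 < e"
    then obtain N where "2 * decay (pvar i) (Suc N) < e" using decay_small by blast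
    then show "\<bar>z t $ i - z' t $ i\<bar> \<le> 0 + e"
      using lie_series[OF x z(1) t, of "pvar i" "Suc N"] lie_series[OF x z(2) t, of "pvar i" "Suc N"]
      by simp
  qed
  then show ?thesis by (simp add: vec_eq_iff)
qed

text \<open>
The Lie series of \<open>W \<circ> a \<tau>\<close> without its constant term is \<open>f \<bullet> \<nabla>\<close> applied to a series; truncating that
series gives \<open>V\<close>.
\<close>

lemma coboundary_approx:
  assumes a: "\<And>x. x \<in> \<Omega> \<Longrightarrow> forward_solution (field_eval f) x (a x)" and e: "0 < e"
  obtains V where "\<And>x. x \<in> \<Omega> \<Longrightarrow> \<bar>peval (dot_grad f V) x - (peval W (a x \<tau>) - peval W x)\<bar> < e"
proof -
  obtain N where N: "1 * decay W (Suc N) < e" using decay_small[OF e] by blast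
  define V where "V = (\<Sum>k<N. pconst (\<tau> ^ Suc k / fact (Suc k)) * (dot_grad f ^^ k) W)"
  have "\<bar>peval (dot_grad f V) x - (peval W (a x \<tau>) - peval W x)\<bar> < e" if x: "x \<in> \<Omega>" for x
  proof -
    have "(\<Sum>k<Suc N. \<tau> ^ k / fact k * peval ((dot_grad f ^^ k) W) x) = peval W x + peval (dot_grad f V) x"
      by (subst sum.lessThan_Suc_shift) (simp add: V_def dot_grad_sum dot_grad_scale)
    then show ?thesis using lie_series[OF x a[OF x], of \<tau> W "Suc N"] \<tau> N by simp
  qed
  then show ?thesis by (rule that)
qed

text \<open>
The series of the average of \<open>W\<close> over \<open>[0, \<tau>]\<close> starts with \<open>W\<close> itself, and the remaining terms are again
\<open>f \<bullet> \<nabla>\<close> of a series.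
\<close>

lemma average_approx:
  assumes a: "\<And>x. x \<in> \<Omega> \<Longrightarrow> forward_solution (field_eval f) x (a x)" and e: "0 < e"
  obtains V where "\<And>x. x \<in> \<Omega> \<Longrightarrow>
     \<bar>peval W x + peval (dot_grad f V) x - integral {0..\<tau>} (\<lambda>s. peval W (a x s)) / \<tau>\<bar> < e"
proof -
  obtain N where N: "1 * decay W (Suc N) < e" using decay_small[OF e] by blast
  define V where "V = (\<Sum>k<N. pconst (\<tau> ^ Suc k / fact (Suc (Suc k))) * (dot_grad f ^^ k) W)"
  have "\<bar>peval W x + peval (dot_grad f V) x - integral {0..\<tau>} (\<lambda>s. peval W (a x s)) / \<tau>\<bar> < e" if x: "x \<in> \<Omega>" for x
  proof -
    have "(\<Sum>k<Suc N. \<tau> ^ Suc k / fact (Suc k) * peval ((dot_grad f ^^ k) W) x) = \<tau> * (peval W x + peval (dot_grad f V) x)"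
      by (subst sum.lessThan_Suc_shift)
         (simp add: V_def dot_grad_sum dot_grad_scale sum_distrib_left distrib_left mult.assoc del: fact_Suc)
    then have "\<bar>integral {0..\<tau>} (\<lambda>s. peval W (a x s)) - \<tau> * (peval W x + peval (dot_grad f V) x)\<bar> \<le> \<tau> * decay W (Suc N)"
      using lie_series_integral[OF x a[OF x], of W "Suc N"] by simp
    also have "\<dots> < \<tau> * e" using \<tau> N by simp
    finally have "\<bar>(integral {0..\<tau>} (\<lambda>s. peval W (a x s)) - \<tau> * (peval W x + peval (dot_grad f V) x)) / \<tau>\<bar> < e"
      using \<tau> by (simp add: abs_divide field_simps)
    moreover have "(integral {0..\<tau>} (\<lambda>s. peval W (a x s)) - \<tau> * (peval W x + peval (dot_grad f V) x)) / \<tau>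
       = - (peval W x + peval (dot_grad f V) x - integral {0..\<tau>} (\<lambda>s. peval W (a x s)) / \<tau>)"
      using \<tau> by (simp add: field_simps)
    ultimately show ?thesis by (simp only: abs_minus_cancel)
  qed
  then show ?thesis by (rule that)
qed

lemma continuous_on_time_map:
  assumes a: "\<And>x. x \<in> \<Omega> \<Longrightarrow> forward_solution (field_eval f) x (a x)"
  shows "continuous_on \<Omega> (\<lambda>x. a x \<tau>)"
proof -
  have "continuous_on \<Omega> (\<lambda>x. a x \<tau> $ i)" for i
  proof (rule continuous_on_approximable)
    fix e :: real assume "0 < e"
    then obtain V where V: "\<And>x. x \<in> \<Omega> \<Longrightarrow> \<bar>peval (dot_grad f V) x - (peval (pvar i) (a x \<tau>) - peval (pvar i) x)\<bar> < e"
      using coboundary_approx[of a e "pvar i"] a by blast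
    have "\<bar>a x \<tau> $ i - peval (pvar i + dot_grad f V) x\<bar> < e" if "x \<in> \<Omega>" for x
      using V[OF that] by simp
    then show "\<exists>p. \<forall>x\<in>\<Omega>. \<bar>a x \<tau> $ i - peval p x\<bar> < e" by blast
  qed
  then have "continuous_on \<Omega> (\<lambda>x. \<chi> i. a x \<tau> $ i)" by (rule continuous_on_vec_lambda)
  then show ?thesis by simp
qed

lemma continuous_on_average:
  assumes a: "\<And>x. x \<in> \<Omega> \<Longrightarrow> forward_solution (field_eval f) x (a x)"
  shows "continuous_on \<Omega> (\<lambda>x. integral {0..\<tau>} (\<lambda>s. peval W (a x s)) / \<tau>)"
proof (rule continuous_on_approximable)
  fix e :: real assume "0 < e"
  then obtain V where V: "\<And>x. x \<in> \<Omega> \<Longrightarrow>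
     \<bar>peval W x + peval (dot_grad f V) x - integral {0..\<tau>} (\<lambda>s. peval W (a x s)) / \<tau>\<bar> < e"
    using average_approx[of a e W] a by blast
  show "\<exists>p. \<forall>x\<in>\<Omega>. \<bar>integral {0..\<tau>} (\<lambda>s. peval W (a x s)) / \<tau> - peval p x\<bar> < e"
    by (rule exI[of _ "W + dot_grad f V"]) (use V in \<open>auto simp: abs_minus_commute\<close>)
qed

end

section \<open>Optimal orbits of a continuous map\<close>

definition orbit_sum :: "('a \<Rightarrow> 'a) \<Rightarrow> ('a \<Rightarrow> real) \<Rightarrow> nat \<Rightarrow> 'a \<Rightarrow> real" where
  "orbit_sum T G N x = (\<Sum>k<N. G ((T ^^ k) x))"

lemma orbit_sum_add: "orbit_sum T G (a + b) x = orbit_sum T G a x + orbit_sum T G b ((T ^^ a) x)"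
proof (induct b)
  case (Suc b)
  have "(T ^^ (a + b)) x = (T ^^ b) ((T ^^ a) x)" by (simp add: add.commute[of a] funpow_add)
  then show ?case using Suc by (simp add: orbit_sum_def)
qed (simp add: orbit_sum_def)

lemma continuous_on_funpow:
  fixes T :: "'a::topological_space \<Rightarrow> 'a"
  assumes "continuous_on UNIV T" shows "continuous_on UNIV (T ^^ k)"
proof (induct k)
  case (Suc k)
  then show ?case
    using continuous_on_compose[OF Suc, of T] continuous_on_subset[OF assms] by simp
qed (simp add: id_def)

lemma continuous_on_orbit_sum:
  assumes "continuous_on UNIV T" "continuous_on UNIV G"
  shows "continuous_on UNIV (orbit_sum T G N)"
  unfolding orbit_sum_def[abs_def]
  by (intro continuous_on_sum continuous_on_compose2[OF assms(2) continuous_on_funpow[OF assms(1)]]) auto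

text \<open>
If every point of \<open>\<Omega>\<close> whose next \<open>n\<close> iterates stay in \<open>\<Omega>\<close> had some average of length at most \<open>n\<close> below
\<open>p - e\<close>, a long segment could be cut greedily into such pieces and a remainder shorter than \<open>n\<close>. Its total
average would then be close to \<open>p - e\<close> at most, contradicting the existence of long segments with average
\<open>p - e / 2\<close>.
\<close>

lemma persistent_lower_average:
  fixes G :: "'a \<Rightarrow> real"
  assumes bounded: "\<And>x. x \<in> \<Omega> \<Longrightarrow> \<bar>G x\<bar> \<le> C"
    and H: "\<And>N e. 0 < e \<Longrightarrow> \<exists>x. (\<forall>k<N. (T ^^ k) x \<in> \<Omega>) \<and> real N * (p - e) \<le> orbit_sum T G N x"
    and e: "0 < e"
  shows "\<exists>y. (\<forall>k<n. (T ^^ k) y \<in> \<Omega>) \<and> (\<forall>j\<le>n. real j * (p - e) \<le> orbit_sum T G j y)"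
proof (rule ccontr)
  assume no: "\<not> ?thesis"
  define D where "D = \<bar>C\<bar> + \<bar>p\<bar> + e"
  have D: "0 \<le> D" "\<bar>C\<bar> \<le> (p - e) + D" using e by (auto simp: D_def)
  have claim: "orbit_sum T G r y \<le> real r * (p - e) + real n * D" if "\<forall>k<r. (T ^^ k) y \<in> \<Omega>" for r y
    using that
  proof (induct r arbitrary: y rule: less_induct)
    case (less r)
    show ?case
    proof (cases "r < n")
      case True
      have "orbit_sum T G r y \<le> (\<Sum>k<r. (p - e) + D)"
        unfolding orbit_sum_def
      proof (rule sum_mono)
        fix k assume "k \<in> {..<r}"
        then show "G ((T ^^ k) y) \<le> p - e + D" using bounded[of "(T ^^ k) y"] less.prems D by (smt (verit) lessThan_iff)
      qed
      also have "\<dots> = real r * (p - e) + real r * D" by (simp add: distrib_left)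
      also have "\<dots> \<le> real r * (p - e) + real n * D" using True D by (intro add_left_mono mult_right_mono) auto
      finally show ?thesis .
    next
      case False
      then have "\<forall>k<n. (T ^^ k) y \<in> \<Omega>" using less.prems by auto
      then obtain j where j: "j \<le> n" "orbit_sum T G j y < real j * (p - e)"
        using no by (meson not_le)
      then have "0 < j" by (cases j) (auto simp: orbit_sum_def)
      have "j \<le> r" using j False by simp
      have "\<forall>k<r - j. (T ^^ k) ((T ^^ j) y) \<in> \<Omega>"
      proof (intro allI impI)
        fix k assume "k < r - j"
        then have "(T ^^ (k + j)) y \<in> \<Omega>" using less.prems by simp
        then show "(T ^^ k) ((T ^^ j) y) \<in> \<Omega>" by (simp add: funpow_add)
      qed
      then have "orbit_sum T G (r - j) ((T ^^ j) y) \<le> real (r - j) * (p - e) + real n * D"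
        using \<open>0 < j\<close> \<open>j \<le> r\<close> by (intro less.hyps) auto
      moreover have "orbit_sum T G r y = orbit_sum T G j y + orbit_sum T G (r - j) ((T ^^ j) y)"
        using orbit_sum_add[of T G j "r - j" y] \<open>j \<le> r\<close> by simp
      moreover have "real (r - j) * (p - e) + real j * (p - e) = real r * (p - e)"
        using \<open>j \<le> r\<close> by (simp add: of_nat_diff algebra_simps)
      ultimately show ?thesis using j by linarith
    qed
  qed
  define N where "N = Suc (nat \<lceil>real n * D / (e / 2)\<rceil>)"
  have "real n * D / (e / 2) < real N" unfolding N_def by linarith
  then have N: "real n * D < real N * (e / 2)" using e by (simp add: pos_divide_less_eq)
  obtain x where "\<forall>k<N. (T ^^ k) x \<in> \<Omega>" "real N * (p - e / 2) \<le> orbit_sum T G N x"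
    using H[of "e / 2" N] e by auto
  then have "real N * (p - e / 2) \<le> real N * (p - e) + real n * D" using claim order_trans by blast
  moreover have "real N * (p - e / 2) = real N * (p - e) + real N * (e / 2)" by (simp add: algebra_simps)
  ultimately show False using N by linarith
qed

text \<open>
A limit of the points of \<open>persistent_lower_average\<close> for \<open>e \<rightarrow> 0\<close> and \<open>n \<rightarrow> \<infinity>\<close>. Each single condition on the
limit involves finitely many iterates and is closed.
\<close>

lemma optimal_orbit_exists:
  fixes T :: "'a::metric_space \<Rightarrow> 'a" and G :: "'a \<Rightarrow> real"
  assumes \<Omega>: "compact \<Omega>" and T: "continuous_on UNIV T" and G: "continuous_on UNIV G"
    and H: "\<And>N e. 0 < e \<Longrightarrow> \<exists>x. (\<forall>k<N. (T ^^ k) x \<in> \<Omega>) \<and> real N * (p - e) \<le> orbit_sum T G N x"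
  shows "\<exists>x. (\<forall>k. (T ^^ k) x \<in> \<Omega>) \<and> (\<forall>N. real N * p \<le> orbit_sum T G N x)"
proof -
  have "bounded (G ` \<Omega>)"
    by (intro compact_imp_bounded compact_continuous_image continuous_on_subset[OF G] \<Omega>) auto
  then obtain C where C: "\<And>x. x \<in> \<Omega> \<Longrightarrow> \<bar>G x\<bar> \<le> C" by (auto simp: bounded_iff)
  have "\<exists>y. (\<forall>k<Suc n. (T ^^ k) y \<in> \<Omega>) \<and> (\<forall>j\<le>Suc n. real j * (p - 1 / real (Suc n)) \<le> orbit_sum T G j y)" for n
    by (rule persistent_lower_average[OF C H]) auto
  then obtain y where y: "\<And>n k. k < Suc n \<Longrightarrow> (T ^^ k) (y n) \<in> \<Omega>"
    "\<And>n j. j \<le> Suc n \<Longrightarrow> real j * (p - 1 / real (Suc n)) \<le> orbit_sum T G j (y n)"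
    by metis
  have "\<forall>n. y n \<in> \<Omega>" using y(1)[of 0] by simp
  then obtain l r where l: "l \<in> \<Omega>" and r: "strict_mono (r :: nat \<Rightarrow> nat)" and lim: "(y \<circ> r) \<longlonglongrightarrow> l"
    using \<Omega> unfolding compact_def by blast
  have conv: "(\<lambda>n. h (y (r n))) \<longlonglongrightarrow> h l" if "continuous_on UNIV h" for h :: "'a \<Rightarrow> 'b::topological_space"
    using continuous_on_tendsto_compose[OF that lim] by (simp add: o_def)
  have large: "\<forall>\<^sub>F n in sequentially. k \<le> r n" for k
    using filterlim_subseq[OF r] by (auto simp: filterlim_at_top)
  have "(T ^^ k) l \<in> \<Omega>" for k
  proof (rule Lim_in_closed_set[OF compact_imp_closed[OF \<Omega>] _ sequentially_bot])
    show "(\<lambda>n. (T ^^ k) (y (r n))) \<longlonglongrightarrow> (T ^^ k) l" by (rule conv[OF continuous_on_funpow[OF T]])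
    show "\<forall>\<^sub>F n in sequentially. (T ^^ k) (y (r n)) \<in> \<Omega>"
      using large[of k] by eventually_elim (auto intro: y)
  qed
  moreover have "real N * p \<le> orbit_sum T G N l" for N
  proof (rule tendsto_le[OF sequentially_bot])
    show "(\<lambda>n. orbit_sum T G N (y (r n))) \<longlonglongrightarrow> orbit_sum T G N l"
      by (rule conv[OF continuous_on_orbit_sum[OF T G]])
    have "(\<lambda>n. 1 / real (Suc n)) \<longlonglongrightarrow> 0"
      using LIMSEQ_inverse_real_of_nat by (simp add: inverse_eq_divide)
    then have "((\<lambda>n. 1 / real (Suc n)) \<circ> r) \<longlonglongrightarrow> 0" using r by (rule LIMSEQ_subseq_LIMSEQ)
    then have "(\<lambda>n. real N * (p - 1 / real (Suc (r n)))) \<longlonglongrightarrow> real N * (p - 0)"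
      by (intro tendsto_intros) (simp add: o_def)
    then show "(\<lambda>n. real N * (p - 1 / real (Suc (r n)))) \<longlonglongrightarrow> real N * p" by simp
    show "\<forall>\<^sub>F n in sequentially. real N * (p - 1 / real (Suc (r n))) \<le> orbit_sum T G N (y (r n))"
      using large[of N] by eventually_elim (rule y(2), simp)
  qed
  ultimately show ?thesis by blast
qed

text \<open>
The weights \<open>1 - (k + 1) / N\<close> for which adding a coboundary turns the value at the first point into the
average over the first \<open>N\<close> points.
\<close>

lemma cesaro_telescope:
  fixes h :: "nat \<Rightarrow> real"
  shows "real N * h 0 + (\<Sum>k<N. (real N - real (Suc k)) * (h (Suc k) - h k)) = (\<Sum>k<N. h k)"
proof (induct N)
  case (Suc N)
  have "(\<Sum>k<N. (real (Suc N) - real (Suc k)) * (h (Suc k) - h k)) =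
     (\<Sum>k<N. (real N - real (Suc k)) * (h (Suc k) - h k)) + (\<Sum>k<N. h (Suc k) - h k)"
    by (simp add: algebra_simps flip: sum.distrib)
  also have "(\<Sum>k<N. h (Suc k) - h k) = h N - h 0" by (rule sum_lessThan_telescope)
  finally show ?case using Suc by (simp add: algebra_simps)
qed simp

text \<open>
Orbits of points of \<open>\<Omega>\<close> may leave \<open>\<Omega>\<close>, where nothing is known about \<open>G\<close>. Subtracting a multiple \<open>K\<close> of
the distance to \<open>\<Omega>\<close> does not change \<open>G\<close> on \<open>\<Omega>\<close>, and for large \<open>K\<close> it makes all averages of length \<open>N\<close>
smaller than \<open>c\<close>: otherwise the bad points for \<open>K \<rightarrow> \<infinity>\<close> would accumulate at a point whose orbit segment
lies in \<open>\<Omega>\<close> and has average at least \<open>c\<close>. By \<open>cesaro_telescope\<close> the average is cohomologous to the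
penalised function.
\<close>

lemma coboundary_certificate:
  fixes T :: "'a::metric_space \<Rightarrow> 'a" and G :: "'a \<Rightarrow> real"
  assumes \<Omega>: "compact \<Omega>" and T: "continuous_on UNIV T" and G: "continuous_on UNIV G" and N: "0 < N"
    and no: "\<And>x. (\<And>k. k < N \<Longrightarrow> (T ^^ k) x \<in> \<Omega>) \<Longrightarrow> orbit_sum T G N x < real N * c"
  shows "\<exists>W \<delta>. continuous_on UNIV W \<and> 0 < \<delta> \<and> (\<forall>x\<in>\<Omega>. G x + W (T x) - W x \<le> c - \<delta>)"
proof (cases "\<Omega> = {}")
  case True
  then show ?thesis by (intro exI[of _ "\<lambda>_. 0"] exI[of _ 1]) auto
next
  case False
  let ?D = "\<lambda>x. infdist x \<Omega>"
  have D: "continuous_on UNIV ?D" by (intro continuous_intros)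
  have SG: "continuous_on UNIV (orbit_sum T G N)" and SD: "continuous_on UNIV (orbit_sum T ?D N)"
    by (rule continuous_on_orbit_sum[OF T G], rule continuous_on_orbit_sum[OF T D])
  have "\<exists>K::nat. \<forall>x\<in>\<Omega>. orbit_sum T G N x - real K * orbit_sum T ?D N x < real N * c"
  proof (rule ccontr)
    assume "\<not> ?thesis"
    then have "\<forall>K::nat. \<exists>x\<in>\<Omega>. real N * c \<le> orbit_sum T G N x - real K * orbit_sum T ?D N x" by (simp add: not_less)
    then obtain x where x: "\<And>K. x K \<in> \<Omega>" "\<And>K. real N * c \<le> orbit_sum T G N (x K) - real K * orbit_sum T ?D N (x K)"
      by metis
    obtain l r where l: "l \<in> \<Omega>" and r: "strict_mono (r :: nat \<Rightarrow> nat)" and lim: "(x \<circ> r) \<longlonglongrightarrow> l"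
      using \<Omega> x(1) unfolding compact_def by blast
    have conv: "(\<lambda>n. h (x (r n))) \<longlonglongrightarrow> h l" if "continuous_on UNIV h" for h :: "'a \<Rightarrow> real"
      using continuous_on_tendsto_compose[OF that lim] by (simp add: o_def)
    have D0: "0 \<le> orbit_sum T ?D N y" for y unfolding orbit_sum_def by (intro sum_nonneg infdist_nonneg)
    have "bounded (orbit_sum T G N ` \<Omega>)"
      by (intro compact_imp_bounded compact_continuous_image continuous_on_subset[OF SG] \<Omega>) auto
    then obtain B where B: "\<And>x. x \<in> \<Omega> \<Longrightarrow> \<bar>orbit_sum T G N x\<bar> \<le> B" by (auto simp: bounded_iff)
    have "orbit_sum T ?D N l \<le> 0"
    proof (rule tendsto_le[OF sequentially_bot])
      show "(\<lambda>n. orbit_sum T ?D N (x (r n))) \<longlonglongrightarrow> orbit_sum T ?D N l" by (rule conv[OF SD])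
      have "(\<lambda>n. (B - real N * c) / real n) \<longlonglongrightarrow> 0" by (rule lim_const_over_n)
      then have "((\<lambda>n. (B - real N * c) / real n) \<circ> r) \<longlonglongrightarrow> 0" using r by (rule LIMSEQ_subseq_LIMSEQ)
      then show "(\<lambda>n. (B - real N * c) / real (r n)) \<longlonglongrightarrow> 0" by (simp add: o_def)
      have "\<forall>\<^sub>F n in sequentially. 1 \<le> r n" using filterlim_subseq[OF r] by (auto simp: filterlim_at_top)
      then show "\<forall>\<^sub>F n in sequentially. orbit_sum T ?D N (x (r n)) \<le> (B - real N * c) / real (r n)"
      proof eventually_elim
        case (elim n)
        have "orbit_sum T ?D N (x (r n)) * real (r n) \<le> B - real N * c"
          using x(2)[of "r n"] B[OF x(1), of "r n"] by (simp add: mult.commute)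
        then show ?case using elim by (subst pos_le_divide_eq) auto
      qed
    qed
    then have "(\<Sum>k<N. ?D ((T ^^ k) l)) = 0" using D0[of l] by (simp add: orbit_sum_def)
    then have "\<And>k. k < N \<Longrightarrow> ?D ((T ^^ k) l) = 0"
      by (subst (asm) sum_nonneg_eq_0_iff) (auto simp: infdist_nonneg)
    then have "\<And>k. k < N \<Longrightarrow> (T ^^ k) l \<in> \<Omega>"
      using in_closed_iff_infdist_zero[OF compact_imp_closed[OF \<Omega>] False] by blast
    then have "orbit_sum T G N l < real N * c" by (rule no)
    moreover have "real N * c \<le> orbit_sum T G N l"
    proof (rule tendsto_le[OF sequentially_bot conv[OF SG] tendsto_const always_eventually], rule allI)
      fix n show "real N * c \<le> orbit_sum T G N (x (r n))"
        using x(2)[of "r n"] mult_nonneg_nonneg[OF of_nat_0_le_iff[of "r n"] D0[of "x (r n)"]] by linarith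
    qed
    ultimately show False by simp
  qed
  then obtain K :: nat where K: "\<And>x. x \<in> \<Omega> \<Longrightarrow> orbit_sum T G N x - real K * orbit_sum T ?D N x < real N * c" by blast
  define H where "H x = G x - real K * ?D x" for x
  have contH: "continuous_on UNIV H" unfolding H_def[abs_def] by (intro continuous_intros G D)
  have SH: "orbit_sum T H N x = orbit_sum T G N x - real K * orbit_sum T ?D N x" for x
    by (simp add: orbit_sum_def H_def sum_subtractf sum_distrib_left)
  define W where "W x = (\<Sum>k<N. (1 - real (Suc k) / real N) * H ((T ^^ k) x))" for x
  have contW: "continuous_on UNIV W"
    unfolding W_def[abs_def]
    by (intro continuous_intros continuous_on_compose2[OF contH continuous_on_funpow[OF T]]) auto
  have tele: "H x + W (T x) - W x = orbit_sum T H N x / real N" for x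
  proof -
    have "W (T x) - W x = (\<Sum>k<N. (1 - real (Suc k) / real N) * (H ((T ^^ Suc k) x) - H ((T ^^ k) x)))"
      by (simp add: W_def funpow_swap1 right_diff_distrib sum_subtractf)
    also have "real N * \<dots> = (\<Sum>k<N. (real N - real (Suc k)) * (H ((T ^^ Suc k) x) - H ((T ^^ k) x)))"
      unfolding sum_distrib_left
      by (rule sum.cong) (use N in \<open>auto simp: field_simps\<close>)
    finally have "real N * (H x + W (T x) - W x) = orbit_sum T H N x"
      using cesaro_telescope[of N "\<lambda>k. H ((T ^^ k) x)"] by (simp add: orbit_sum_def algebra_simps)
    then show ?thesis using N by (simp add: field_simps)
  qed
  have "continuous_on \<Omega> (orbit_sum T H N)"
    by (rule continuous_on_subset[OF continuous_on_orbit_sum[OF T contH]]) auto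
  then obtain x0 where x0: "x0 \<in> \<Omega>" "\<And>x. x \<in> \<Omega> \<Longrightarrow> orbit_sum T H N x \<le> orbit_sum T H N x0"
    using continuous_attains_sup[OF \<Omega> False] by blast
  define \<delta> where "\<delta> = c - orbit_sum T H N x0 / real N"
  have "0 < \<delta>" using K[OF x0(1)] N by (simp add: \<delta>_def SH field_simps)
  moreover have "G x + W (T x) - W x \<le> c - \<delta>" if "x \<in> \<Omega>" for x
  proof -
    have "G x = H x" using that by (simp add: H_def)
    then have "G x + W (T x) - W x = orbit_sum T H N x / real N" using tele by simp
    also have "\<dots> \<le> orbit_sum T H N x0 / real N" using x0(2)[OF that] N by (simp add: divide_right_mono)
    finally show ?thesis by (simp add: \<delta>_def)
  qed
  ultimately show ?thesis using contW by blast
qed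

section \<open>Sums-of-squares bounds and time averages\<close>

text \<open>
The values \<open>l\<close> certified by some \<open>V\<close>, without restriction on degrees.
\<close>

definition feasible :: "('n::finite \<Rightarrow> 'n rpoly) \<Rightarrow> 'n rpoly \<Rightarrow> nat \<Rightarrow> (nat \<Rightarrow> 'n rpoly) \<Rightarrow> real set" where
  "feasible f \<Phi> m g = {l. \<exists>V. pconst l - \<Phi> - dot_grad f V \<in> qmod m g}"

lemma sos_nonneg: "s \<in> sos \<Longrightarrow> 0 \<le> peval s x"
  by (auto simp: sos_def sum_nonneg)

lemma qmod_nonneg:
  assumes "p \<in> qmod m g" "x \<in> semialg_set m g" shows "0 \<le> peval p x"
proof -
  obtain \<sigma> where p: "p = \<sigma> 0 + (\<Sum>i=1..m. \<sigma> i * g i)" "\<forall>i\<le>m. \<sigma> i \<in> sos"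
    using assms(1) by (auto simp: qmod_def)
  have "0 \<le> peval (\<sigma> i) x" if "i \<le> m" for i using p(2) that sos_nonneg by blast
  then show ?thesis
    using assms(2) unfolding p(1) by (auto simp: semialg_set_def intro!: add_nonneg_nonneg sum_nonneg mult_nonneg_nonneg)
qed

lemma feasible_nonneg:
  assumes "pconst l - \<Phi> - dot_grad f V \<in> qmod m g" "x \<in> semialg_set m g"
  shows "peval \<Phi> x + peval (dot_grad f V) x \<le> l"
  using qmod_nonneg[OF assms] by simp

text \<open>
The quantity \<open>\<integral>\<Phi> + V - l T\<close> decreases as soon as the trajectory is in \<open>\<Omega>\<close>, where \<open>V\<close> is bounded.
\<close>

lemma integral_along_solution_le:
  fixes z :: "real \<Rightarrow> real ^ 'n::finite"
  assumes z: "forward_solution (field_eval f) x z" and t0: "0 \<le> t0" "\<And>t. t0 \<le> t \<Longrightarrow> z t \<in> \<Omega>"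
    and \<Omega>: "compact \<Omega>" and le: "\<And>y. y \<in> \<Omega> \<Longrightarrow> peval \<Phi> y + peval (dot_grad f V) y \<le> l"
  shows "\<exists>C. \<forall>T\<ge>t0. integral {0..T} (\<lambda>t. peval \<Phi> (z t)) \<le> l * T + C"
proof -
  have "bounded (peval V ` \<Omega>)"
    by (intro compact_imp_bounded compact_continuous_image \<Omega> continuous_intros)
  then obtain B where B: "\<And>y. y \<in> \<Omega> \<Longrightarrow> \<bar>peval V y\<bar> \<le> B" by (auto simp: bounded_iff)
  define J where "J T = integral {0..T} (\<lambda>t. peval \<Phi> (z t)) + peval V (z T) - l * T" for T
  have "integral {0..T} (\<lambda>t. peval \<Phi> (z t)) \<le> l * T + (J t0 + B)" if T: "t0 \<le> T" for T
  proof -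
    have "continuous_on {0..T} (\<lambda>s. peval \<Phi> (z s))"
      by (intro continuous_intros continuous_on_subset[OF solution_continuous[OF z]]) auto
    then have "((\<lambda>T. integral {0..T} (\<lambda>t. peval \<Phi> (z t))) has_real_derivative peval \<Phi> (z s)) (at s within {0..T})"
      if "0 \<le> s" "s \<le> T" for s using that by (intro integral_has_real_derivative) auto
    then have "(J has_real_derivative (peval \<Phi> (z s) + peval (dot_grad f V) (z s) - l)) (at s within {t0..T})"
      if "t0 \<le> s" "s \<le> T" for s
      unfolding J_def[abs_def] using that t0(1) z
      by (auto intro!: derivative_eq_intros has_field_derivative_subset[OF peval_along_solution[of z f s "{0..}" V], of "{t0..T}"]
           intro: has_field_derivative_subset[of _ _ s "{0..T}" "{t0..T}"] simp: forward_solution_def)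
    then have "((\<lambda>s. peval \<Phi> (z s) + peval (dot_grad f V) (z s) - l) has_integral J T - J t0) {t0..T}"
      by (intro fundamental_theorem_of_calculus T) (auto simp: has_real_derivative_iff_has_vector_derivative)
    then have "J T - J t0 \<le> 0"
      by (rule has_integral_le[OF _ has_integral_0]) (use le t0(2) in \<open>force simp: algebra_simps\<close>)
    then show ?thesis using B[OF t0(2)[OF T]] by (simp add: J_def abs_le_iff)
  qed
  then show ?thesis by blast
qed

lemma time_average_le:
  assumes "\<exists>C. \<forall>T\<ge>t0. integral {0..T} (\<lambda>t. peval \<Phi> (a x t)) \<le> l * T + C"
  shows "time_average \<Phi> a x \<le> ereal l"
proof (rule ereal_le_epsilon2)
  fix e :: real assume e: "0 < e"
  obtain C where C: "\<And>T. t0 \<le> T \<Longrightarrow> integral {0..T} (\<lambda>t. peval \<Phi> (a x t)) \<le> l * T + C" using assms by blast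
  have "\<forall>\<^sub>F T in at_top. ereal (1 / T * integral {0..T} (\<lambda>t. peval \<Phi> (a x t))) \<le> ereal (l + e)"
    using eventually_ge_at_top[of t0] eventually_ge_at_top[of "\<bar>C\<bar> / e"] eventually_gt_at_top[of 0]
  proof eventually_elim
    case (elim T)
    have "C \<le> T * e" using elim(2) e by (simp add: pos_divide_le_eq)
    then have "integral {0..T} (\<lambda>t. peval \<Phi> (a x t)) \<le> (l + e) * T" using C[OF elim(1)] by (simp add: algebra_simps)
    then show ?case using elim(3) by (simp add: pos_divide_le_eq)
  qed
  then show "time_average \<Phi> a x \<le> ereal l + ereal e"
    unfolding time_average_def by (intro Limsup_bounded) simp
qed

lemma time_average_ge:
  assumes \<tau>: "0 < \<tau>"
    and ge: "\<And>N::nat. real N * \<tau> * l \<le> integral {0..real N * \<tau>} (\<lambda>t. peval \<Phi> (a x t))"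
  shows "ereal l \<le> time_average \<Phi> a x"
proof (rule ccontr)
  assume "\<not> ?thesis"
  then have "\<forall>\<^sub>F T in at_top. ereal (1 / T * integral {0..T} (\<lambda>t. peval \<Phi> (a x t))) < ereal l"
    unfolding time_average_def by (intro Limsup_lessD) simp
  then obtain T0 where T0: "\<And>T. T0 \<le> T \<Longrightarrow> 1 / T * integral {0..T} (\<lambda>t. peval \<Phi> (a x t)) < l"
    by (auto simp: eventually_at_top_linorder)
  obtain N :: nat where N: "\<bar>T0\<bar> / \<tau> < real N" using reals_Archimedean2 by blast
  then have "\<bar>T0\<bar> < real N * \<tau>" using \<tau> by (simp add: pos_divide_less_eq)
  then have T: "T0 \<le> real N * \<tau>" "0 < real N * \<tau>" by auto
  have "l \<le> 1 / (real N * \<tau>) * integral {0..real N * \<tau>} (\<lambda>t. peval \<Phi> (a x t))"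
    using ge[of N] T(2) by (simp add: pos_le_divide_eq mult.commute)
  then show False using T0[OF T(1)] by simp
qed

lemma forward_solution_shift:
  assumes "forward_solution F x z" "0 \<le> s"
  shows "forward_solution F (z s) (\<lambda>t. z (s + t))"
  unfolding forward_solution_def
proof (intro conjI allI impI)
  fix t :: real assume t: "0 \<le> t"
  have "(z has_vector_derivative F (z (s + t))) (at (s + t) within {0..})"
    using assms t by (simp add: forward_solution_def)
  then have "(z has_vector_derivative F (z (s + t))) (at (s + t) within (+) s ` {0..})"
    by (rule has_vector_derivative_within_subset) (use assms(2) in auto)
  moreover have "((+) s has_vector_derivative 1) (at t within {0..})"
    by (auto intro!: derivative_eq_intros simp: has_vector_derivative_def)
  ultimately show "((\<lambda>t. z (s + t)) has_vector_derivative F (z (s + t))) (at t within {0..})"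
    using vector_diff_chain_within[of "(+) s" 1 t "{0..}" z "F (z (s + t))"] by (simp add: o_def)
qed simp

context lie_flow
begin

text \<open>
The semigroup law, obtained from uniqueness for short times since all the points \<open>a x (k \<tau>)\<close> lie in \<open>\<Omega>\<close>.
Only the values of \<open>T\<close> on \<open>\<Omega>\<close> matter, so \<open>T\<close> may be any extension of the time-\<open>\<tau>\<close> map.
\<close>

lemma orbit_of_time_map:
  assumes a: "\<And>x. forward_solution (field_eval f) x (a x)"
    and T: "\<And>x. x \<in> \<Omega> \<Longrightarrow> T x = a x \<tau>" and orbit: "\<And>k. (T ^^ k) x \<in> \<Omega>"
  shows "a x (real k * \<tau>) = (T ^^ k) x"
    and "0 \<le> t \<Longrightarrow> t \<le> \<tau> \<Longrightarrow> a x (real k * \<tau> + t) = a ((T ^^ k) x) t"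
proof -
  have step: "a x (real k * \<tau> + t) = a ((T ^^ k) x) t"
    if "a x (real k * \<tau>) = (T ^^ k) x" "0 \<le> t" "t \<le> \<tau>" for k t
  proof -
    have "forward_solution (field_eval f) (a x (real k * \<tau>)) (\<lambda>t. a x (real k * \<tau> + t))"
      by (rule forward_solution_shift[OF a]) (use \<tau> in simp)
    then show ?thesis
      using solution_unique[OF orbit[of k], of "\<lambda>t. a x (real k * \<tau> + t)" "a ((T ^^ k) x)" t] a that by simp
  qed
  show eq: "a x (real k * \<tau>) = (T ^^ k) x" for k
  proof (induct k)
    case 0
    show ?case using a[of x] by (simp add: forward_solution_def)
  next
    case (Suc k)
    have "a x (real k * \<tau> + \<tau>) = a ((T ^^ k) x) \<tau>" by (rule step[OF Suc]) (use \<tau> in auto)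
    also have "\<dots> = (T ^^ Suc k) x" using T[OF orbit[of k]] by simp
    finally show ?case by (simp add: algebra_simps)
  qed
  show "a x (real k * \<tau> + t) = a ((T ^^ k) x) t" if "0 \<le> t" "t \<le> \<tau>" using step[OF eq that] .
qed

lemma integral_orbit:
  assumes a: "\<And>x. forward_solution (field_eval f) x (a x)"
    and T: "\<And>x. x \<in> \<Omega> \<Longrightarrow> T x = a x \<tau>"
    and G: "\<And>x. x \<in> \<Omega> \<Longrightarrow> G x = integral {0..\<tau>} (\<lambda>s. peval \<Phi> (a x s)) / \<tau>"
    and orbit: "\<And>k. (T ^^ k) x \<in> \<Omega>"
  shows "integral {0..real N * \<tau>} (\<lambda>t. peval \<Phi> (a x t)) = \<tau> * orbit_sum T G N x"
proof (induct N)
  case (Suc N)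
  let ?h = "\<lambda>t. peval \<Phi> (a x t)"
  have N: "0 \<le> real N * \<tau>" "real N * \<tau> \<le> real (Suc N) * \<tau>" using \<tau> by auto
  have "continuous_on {0..real (Suc N) * \<tau>} ?h"
    by (intro continuous_intros continuous_on_subset[OF solution_continuous[OF a]]) auto
  then have int: "?h integrable_on {0..real (Suc N) * \<tau>}" by (rule integrable_continuous_interval)
  have "integral {real N * \<tau>..real (Suc N) * \<tau>} ?h = integral {0..\<tau>} (\<lambda>s. ?h (real N * \<tau> + s))"
    using integral_shift_Icc_real[of 0 \<tau> ?h "real N * \<tau>"] by (simp add: o_def algebra_simps)
  also have "\<dots> = integral {0..\<tau>} (\<lambda>s. peval \<Phi> (a ((T ^^ N) x) s))"
    by (rule integral_cong) (use orbit_of_time_map(2)[OF a T orbit] in simp)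
  also have "\<dots> = \<tau> * G ((T ^^ N) x)" using G[OF orbit[of N]] \<tau> by simp
  finally show ?case
    using Henstock_Kurzweil_Integration.integral_combine[OF N int] Suc by (simp add: orbit_sum_def distrib_left)
qed (simp add: orbit_sum_def)

text \<open>
If there is no such orbit segment, \<open>coboundary_certificate\<close> provides \<open>W\<close>. The polynomial \<open>V\<close> is assembled
from an approximation of \<open>W \<circ> T - W\<close> and one of \<open>G - \<Phi>\<close>; Putinar's theorem makes \<open>l\<close> feasible.
\<close>

lemma infeasible_orbit:
  assumes \<Omega>: "\<Omega> = semialg_set m g" "compact \<Omega>" and arch: "pconst L - norm_sq_poly \<in> qmod m g"
    and a: "\<And>x. forward_solution (field_eval f) x (a x)"
    and T: "continuous_on UNIV T" "\<And>x. x \<in> \<Omega> \<Longrightarrow> T x = a x \<tau>"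
    and G: "continuous_on UNIV G" "\<And>x. x \<in> \<Omega> \<Longrightarrow> G x = integral {0..\<tau>} (\<lambda>s. peval \<Phi> (a x s)) / \<tau>"
    and N: "0 < N" and inf: "l \<notin> feasible f \<Phi> m g"
  shows "\<exists>x. (\<forall>k<N. (T ^^ k) x \<in> \<Omega>) \<and> real N * l \<le> orbit_sum T G N x"
proof (rule ccontr)
  assume "\<not> ?thesis"
  then have "\<And>x. (\<And>k. k < N \<Longrightarrow> (T ^^ k) x \<in> \<Omega>) \<Longrightarrow> orbit_sum T G N x < real N * l"
    by (meson not_le)
  from coboundary_certificate[OF \<Omega>(2) T(1) G(1) N this]
  obtain W \<delta> where W: "continuous_on UNIV W" and \<delta>: "0 < \<delta>"
    and cert: "\<And>x. x \<in> \<Omega> \<Longrightarrow> G x + W (T x) - W x \<le> l - \<delta>" by blast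
  have K: "compact (\<Omega> \<union> T ` \<Omega>)"
    by (intro compact_Un \<Omega>(2) compact_continuous_image continuous_on_subset[OF T(1)]) auto
  \<comment> \<open>four approximation errors are made below: two for \<open>W\<close>, one for the coboundary, one for the average\<close>
  have \<delta>5: "0 < \<delta> / 5" using \<delta> by simp
  obtain P where P: "\<And>x. x \<in> \<Omega> \<union> T ` \<Omega> \<Longrightarrow> \<bar>W x - peval P x\<bar> < \<delta> / 5"
    using peval_dense[OF K continuous_on_subset[OF W] \<delta>5] by blast
  obtain V where V: "\<And>x. x \<in> \<Omega> \<Longrightarrow> \<bar>peval (dot_grad f V) x - (peval P (a x \<tau>) - peval P x)\<bar> < \<delta> / 5"
    using coboundary_approx[OF a \<delta>5] by blast
  obtain U where U: "\<And>x. x \<in> \<Omega> \<Longrightarrow> \<bar>peval \<Phi> x + peval (dot_grad f U) x - integral {0..\<tau>} (\<lambda>s. peval \<Phi> (a x s)) / \<tau>\<bar> < \<delta> / 5"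
    using average_approx[OF a \<delta>5] by blast
  have "pconst l - \<Phi> - dot_grad f (U + V) \<in> qmod m g"
  proof (rule putinar[OF arch])
    fix x assume "x \<in> semialg_set m g"
    then have x: "x \<in> \<Omega>" by (simp add: \<Omega>(1))
    have Tx: "T x \<in> \<Omega> \<union> T ` \<Omega>" and x': "x \<in> \<Omega> \<union> T ` \<Omega>" using x by auto
    have 1: "peval (dot_grad f V) x < peval P (T x) - peval P x + \<delta> / 5"
      using V[OF x] unfolding T(2)[OF x] by linarith
    have 2: "peval \<Phi> x + peval (dot_grad f U) x < G x + \<delta> / 5"
      using U[OF x] G(2)[OF x] by linarith
    have 3: "peval P (T x) < W (T x) + \<delta> / 5" "W x < peval P x + \<delta> / 5"
      using P[OF Tx] P[OF x'] by linarith+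
    show "0 < peval (pconst l - \<Phi> - dot_grad f (U + V)) x"
      using 1 2 3 cert[OF x] \<delta> by (simp add: dot_grad_add)
  qed
  then show False using inf by (auto simp: feasible_def)
qed

end

lemma Lambda_subset_qmod: "Lambda f \<Phi> s m g d \<subseteq> qmod m g"
proof
  fix p assume "p \<in> Lambda f \<Phi> s m g d"
  then obtain \<sigma> where p: "p = \<sigma> 0 + (\<Sum>i=1..m. \<sigma> i * g i)" "\<sigma> 0 \<in> SOS (rdeg f \<Phi> d)"
    "\<forall>i\<in>{1..m}. \<sigma> i \<in> SOS (rdeg f \<Phi> d - int s)" unfolding Lambda_def by blast
  have "\<sigma> i \<in> sos" if "i \<le> m" for i
    using p(2,3) that by (cases i) (auto simp: SOS_def sos_def)
  then show "p \<in> qmod m g" unfolding qmod_def using p(1) by blast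
qed

text \<open>
The finitely many multipliers have some degree, and the degree bounds in \<open>Lambda\<close> tend to infinity with \<open>d\<close>
since \<open>rdeg f \<Phi> d \<ge> d - 1\<close>.
\<close>

lemma qmod_in_Lambda:
  assumes "p \<in> qmod m g"
  obtains d0 where "\<And>d. d0 \<le> d \<Longrightarrow> p \<in> Lambda f \<Phi> s m g d"
proof -
  obtain \<sigma> where p: "p = \<sigma> 0 + (\<Sum>i=1..m. \<sigma> i * g i)" "\<forall>i\<le>m. \<sigma> i \<in> sos"
    using assms unfolding qmod_def by blast
  define d0 where "d0 = int (\<Sum>i\<le>m. pdeg (\<sigma> i)) + int s + 1"
  have "p \<in> Lambda f \<Phi> s m g d" if d: "d0 \<le> d" for d
  proof -
    have deg: "int (pdeg (\<sigma> i)) \<le> rdeg f \<Phi> d - int s" if "i \<le> m" for i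
    proof -
      have "pdeg (\<sigma> i) \<le> (\<Sum>i\<le>m. pdeg (\<sigma> i))" using that by (intro member_le_sum) auto
      then show ?thesis using d unfolding d0_def rdeg_def by linarith
    qed
    have "\<sigma> i \<in> SOS (rdeg f \<Phi> d - int s)" if "i \<le> m" for i
      using deg[OF that] p(2) that by (auto simp: SOS_def sos_def)
    moreover have "\<sigma> 0 \<in> SOS (rdeg f \<Phi> d)"
      using deg[of 0] p(2) by (auto simp: SOS_def sos_def)
    ultimately show ?thesis unfolding Lambda_def using p(1) by fastforce
  qed
  then show ?thesis by (rule that)
qed

theorem theorem1:
  fixes f :: "'n::finite \<Rightarrow> 'n rpoly"
    and \<Phi> :: "'n rpoly"
    and a :: "real ^ 'n \<Rightarrow> real \<Rightarrow> real ^ 'n"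
    and m s :: nat
    and g :: "nat \<Rightarrow> 'n rpoly"
    and \<Omega> :: "(real ^ 'n) set"
  assumes solution: "\<And>a0. forward_solution (field_eval f) a0 (a a0)"
    and deg_g: "\<And>i. i \<in> {1..m} \<Longrightarrow> pdeg (g i) \<le> s"
    and Omega: "\<Omega> = semialg_set m g"
    and compact_Omega: "compact \<Omega>"
    and absorbing: "\<And>a0. \<exists>t0\<ge>0. \<forall>t\<ge>t0. a a0 t \<in> \<Omega>"
    and ball_constraint: "\<exists>L d. rdeg f \<Phi> d \<ge> int s \<and> pconst L - norm_sq_poly \<in> Lambda f \<Phi> s m g d"
  shows "(sos_bound f \<Phi> s m g \<longlongrightarrow> max_time_average \<Phi> a \<Omega>)
           (inf at_top (principal {d. rdeg f \<Phi> d \<ge> int s}))"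
proof -
  obtain L where arch: "pconst L - norm_sq_poly \<in> qmod m g"
    using ball_constraint Lambda_subset_qmod by blast
  let ?F = "feasible f \<Phi> m g"
  have upper: "\<exists>t0 C. \<forall>T\<ge>t0. integral {0..T} (\<lambda>t. peval \<Phi> (a x t)) \<le> l * T + C" if l: "l \<in> ?F" for x l
  proof -
    obtain V where V: "pconst l - \<Phi> - dot_grad f V \<in> qmod m g" using l unfolding feasible_def by blast
    obtain t0 where "0 \<le> t0" "\<And>t. t0 \<le> t \<Longrightarrow> a x t \<in> \<Omega>" using absorbing by blast
    from integral_along_solution_le[OF solution this compact_Omega, of \<Phi> V l] feasible_nonneg[OF V]
    show ?thesis by (auto simp: Omega)
  qed
  have "bounded (peval \<Phi> ` \<Omega>)"
    by (intro compact_imp_bounded compact_continuous_image compact_Omega continuous_intros)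
  then obtain B where B: "\<And>y. y \<in> \<Omega> \<Longrightarrow> \<bar>peval \<Phi> y\<bar> \<le> B" by (auto simp: bounded_iff)
  have "pconst (B + 1) - \<Phi> - dot_grad f 0 \<in> qmod m g"
  proof (rule putinar[OF arch])
    fix x assume "x \<in> semialg_set m g"
    then show "0 < peval (pconst (B + 1) - \<Phi> - dot_grad f 0) x"
      using B[of x] by (simp add: Omega abs_le_iff)
  qed
  then have nonempty: "?F \<noteq> {}" unfolding feasible_def by blast
  \<comment> \<open>along any trajectory the integral of \<open>\<Phi>\<close> over \<open>[0, T]\<close> lies between \<open>- B T\<close> and \<open>l T\<close> up to constants\<close>
  have lower: "- B \<le> l" if l: "l \<in> ?F" for l
  proof (rule ccontr)
    assume "\<not> - B \<le> l"
    then have neg: "0 < - B - l" by simp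
    obtain t1 C1 where C1: "\<And>T. t1 \<le> T \<Longrightarrow> integral {0..T} (\<lambda>t. peval \<Phi> (a 0 t)) \<le> l * T + C1"
      using upper[OF l] by blast
    obtain t2 where t2: "0 \<le> t2" "\<And>t. t2 \<le> t \<Longrightarrow> a 0 t \<in> \<Omega>" using absorbing by blast
    have "peval (- \<Phi>) y + peval (dot_grad f 0) y \<le> B" if "y \<in> \<Omega>" for y
      using B[OF that] by (simp add: abs_le_iff)
    from integral_along_solution_le[OF solution t2 compact_Omega this]
    obtain C2 where C2: "\<And>T. t2 \<le> T \<Longrightarrow> - integral {0..T} (\<lambda>t. peval \<Phi> (a 0 t)) \<le> B * T + C2" by auto
    define T where "T = max (max t1 t2) ((\<bar>C1 + C2\<bar> + 1) / (- B - l))"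
    have "t1 \<le> T" "t2 \<le> T" by (simp_all add: T_def)
    from C1[OF this(1)] C2[OF this(2)] have "- (C1 + C2) \<le> (B + l) * T" by (simp add: algebra_simps)
    moreover have "(\<bar>C1 + C2\<bar> + 1) / (- B - l) \<le> T" by (simp add: T_def)
    then have "\<bar>C1 + C2\<bar> + 1 \<le> T * (- B - l)" using neg by (simp only: pos_divide_le_eq)
    ultimately show False by (simp add: algebra_simps)
  qed
  then have bdd: "bdd_below ?F" by (intro bdd_belowI)
  define p where "p = Inf ?F"
  have p_le: "p \<le> l" if "l \<in> ?F" for l unfolding p_def using that bdd by (rule cInf_lower)
  have p_less: "\<exists>l\<in>?F. l < c" if "p < c" for c
    using that cInf_less_iff[OF nonempty bdd] by (simp add: p_def)

  obtain R \<tau> where "lie_flow f \<Omega> R \<tau>" using lie_flow_exists[OF compact_imp_bounded[OF compact_Omega]] by blast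
  then interpret lie_flow f \<Omega> R \<tau> .
  have clo: "closedin (top_of_set UNIV) \<Omega>" using compact_imp_closed[OF compact_Omega] by simp
  \<comment> \<open>\<open>T\<close> and \<open>G\<close> extend the time-\<open>\<tau>\<close> map and the short-time average, known to be continuous on \<open>\<Omega>\<close> only, to the whole space\<close>
  obtain T where T: "continuous_on UNIV T" "\<And>x. x \<in> \<Omega> \<Longrightarrow> T x = a x \<tau>"
    using Tietze_unbounded[OF continuous_on_time_map[OF solution] clo] by blast
  obtain G where G: "continuous_on UNIV G" "\<And>x. x \<in> \<Omega> \<Longrightarrow> G x = integral {0..\<tau>} (\<lambda>s. peval \<Phi> (a x s)) / \<tau>"
    using Tietze_unbounded[OF continuous_on_average[OF solution] clo] by blast
  have "\<exists>x. (\<forall>k<N. (T ^^ k) x \<in> \<Omega>) \<and> real N * (p - e) \<le> orbit_sum T G N x" if e: "0 < e" for N e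
  proof (cases "N = 0")
    case False
    have "p - e \<notin> ?F" using p_le e by fastforce
    with False show ?thesis
      by (intro infeasible_orbit[OF Omega compact_Omega arch solution T G]) auto
  qed (simp add: orbit_sum_def)
  from optimal_orbit_exists[OF compact_Omega T(1) G(1) this]
  obtain x where x: "\<And>k. (T ^^ k) x \<in> \<Omega>" "\<And>N. real N * p \<le> orbit_sum T G N x" by blast
  have "ereal p \<le> time_average \<Phi> a x"
  proof (rule time_average_ge[OF \<tau>])
    fix N :: nat
    have "\<tau> * (real N * p) \<le> \<tau> * orbit_sum T G N x" using x(2) \<tau> by (intro mult_left_mono) auto
    then show "real N * \<tau> * p \<le> integral {0..real N * \<tau>} (\<lambda>t. peval \<Phi> (a x t))"
      using integral_orbit[of a T G \<Phi> x N, OF solution T(2) G(2) x(1)] by (simp add: mult_ac)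
  qed
  moreover have avg_le: "time_average \<Phi> a y \<le> ereal p" for y
  proof (rule ereal_le_epsilon2)
    fix e :: real assume "0 < e"
    then obtain l where l: "l \<in> ?F" "l < p + e" using p_less[of "p + e"] by auto
    obtain t0 where "\<exists>C. \<forall>T\<ge>t0. integral {0..T} (\<lambda>t. peval \<Phi> (a y t)) \<le> l * T + C" using upper[OF l(1)] by blast
    then have "time_average \<Phi> a y \<le> ereal l" by (rule time_average_le)
    also have "\<dots> \<le> ereal p + ereal e" using l(2) by simp
    finally show "time_average \<Phi> a y \<le> ereal p + ereal e" .
  qed
  ultimately have "time_average \<Phi> a x = ereal p" by (intro antisym)
  moreover have "x \<in> \<Omega>" using x(1)[of 0] by simp
  ultimately have max: "max_time_average \<Phi> a \<Omega> = ereal p"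
    unfolding max_time_average_def by (intro Greatest_equality) (use avg_le in \<open>force+\<close>)
  have bound_ge: "ereal p \<le> sos_bound f \<Phi> s m g d" for d
    unfolding sos_bound_def
    by (rule Inf_greatest) (use Lambda_subset_qmod p_le in \<open>fastforce simp: feasible_def\<close>)
  show ?thesis
    unfolding max
  proof (rule order_tendstoI)
    fix c assume "c < ereal p"
    then show "\<forall>\<^sub>F d in inf at_top (principal {d. int s \<le> rdeg f \<Phi> d}). c < sos_bound f \<Phi> s m g d"
      using bound_ge by (intro always_eventually allI) (rule less_le_trans)
  next
    fix c assume c: "ereal p < c"
    then obtain r where r: "p < r" "ereal r \<le> c" by (metis ereal_dense2 ereal_less(2) less_ereal.simps(1) less_imp_le)
    then obtain l where l: "l \<in> ?F" "l < r" using p_less by blast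
    then obtain V where V: "pconst l - \<Phi> - dot_grad f V \<in> qmod m g" unfolding feasible_def by blast
    then obtain d0 where d0: "\<And>d. d0 \<le> d \<Longrightarrow> pconst l - \<Phi> - dot_grad f V \<in> Lambda f \<Phi> s m g d"
      using qmod_in_Lambda by blast
    have "\<forall>\<^sub>F d in at_top. sos_bound f \<Phi> s m g d < c"
      using eventually_ge_at_top[of "max d0 (int (pdeg V))"]
    proof eventually_elim
      case (elim d)
      then have "sos_bound f \<Phi> s m g d \<le> ereal l"
        unfolding sos_bound_def using d0[of d] by (intro Inf_lower) (auto simp: Pi_poly_def)
      also have "\<dots> < ereal r" using l(2) by simp
      finally show ?case using r(2) by (rule less_le_trans)
    qed
    then show "\<forall>\<^sub>F d in inf at_top (principal {d. int s \<le> rdeg f \<Phi> d}). sos_bound f \<Phi> s m g d < c"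
      by (simp add: eventually_inf_principal eventually_mono)
  qed
qed

end
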